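(* Let $n\ge2$ and let $(\tau_k,k\ge0)$ be the Markov chain on $\mathbb T_n^o$ with the transition rule described in the context. Then $\mathbb T_n^{b,o}$ is the only closed communicating class of $(\tau_k,k\ge0)$, the chain has a unique stationary distribution $\pi$, which is supported by $\mathbb T_n^{b,o}$, and the distribution of $\tau_k$ converges to $\pi$ as $k\to\infty$.
   Context: $\mathbb T_n^o$ is the set of rooted unlabelled (combinatorial) trees with $n$ leaves in which no vertex other than the root has degree two; $\mathbb T_n^{b,o}\subset\mathbb T_n^o$ consists of the binary ones, i.e. root of degree one and all other non-leaf vertices of degree three. Trees are viewed as $\mathbb R$-trees with unit edge lengths, and each tree with $m$ leaves carries the uniform probability on its leaves. For a rooted tree and a subtree $\mathcal R\ni\rho$, $\pi^{\mathcal R}(\sigma)$ is the point of the path from $\rho$ to $\sigma$ in $\mathcal R$ farthest from $\rho$. Transition rule: given $\tau_0=T$ with root $\rho$: (i) choose an edge $u\to v$ of $T$ uniformly at random and replace it by edges $u\to w$, $w\to v$, $w\to\ell$ with a new vertex $w$ and new leaf $\ell$, giving $T_{+1}$ with $n+1$ leaves; (ii) choose two distinct leaves $\Sigma_1,\widetilde\Sigma_1$ of $T_{+1}$ uniformly at random; let $\Omega$ be the branch point of the reduced tree $\mathcal R_2$ spanned by $\rho,\Sigma_1,\widetilde\Sigma_1$; (iii) assign labels $2,\ldots,n$ to the remaining $n-1$ leaves by a uniform random bijection; (iv) with branches $E_1=[[\rho,\Omega[[$, $E_2=]]\Omega,\Sigma_1[[$, $E_3=[[\Omega,\widetilde\Sigma_1[[$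 (left endpoints $\rho,\Omega,\Omega$), subtrees $\mathcal S_x=(\pi^{\mathcal R_2})^{-1}(x)$, masses $\mu_{\mathcal R_2}(x)=\mu(\mathcal S_x)$, let $Y_j:=\pi^{\mathcal R_2}(\text{leaf labelled }j)$, $j=2,\ldots,n$. Cut points: $E_i^{(1)}=E_i$, $J_0=1$; $X_k=Y_{J_k}$ with $J_k=\min\{j>J_{k-1}:Y_j\in E^{(k)}\}$, $E^{(k)}=\bigcup_iE_i^{(k)}$ (while such $j$ exists), and $E_i^{(k+1)}=E_i^{(k)}\setminus[[\rho_i,X_k]]$ if $X_k\in E_i^{(k)}$, otherwise unchanged. The block $B_k$ is the segment of the branch of $X_k$ from the previous cut point on that branch (excluded), or from the branch's start point if there is none, up to $X_k$ (included). The new spine is $\rho$ followed by the concatenation $B_1,B_2,\ldots$ in order, followed by the leaf $\Sigma_1$ (parts of branches beyond their last cut point contain no vertices); if a start point $\rho$ or $\Omega$ lies in a block which is not the first, it is identified with the endpoint of the preceding block and the subtrees hanging there are joined at their roots. Each $\mathcal S_x$ is reattached at $x$; the leaf $\widetilde\Sigma_1$ is lost. Forgetting labels and edge lengths gives $\tau_1\in\mathbb T_n^o$. *)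

theory Defs
  imports "HOL-Probability.Probability" "HOL-Library.Multiset"
          "HOL-Combinatorics.Multiset_Permutations"
begin

text \<open>Isomorphism classes of finite rooted (unordered) trees: a vertex is the
multiset of the subtrees rooted at its children.\<close>
datatype utree = UNd "utree multiset"

text \<open>Number of leaves of a subtree hanging below a non-root vertex.\<close>
primrec lcount :: "utree \<Rightarrow> nat" where
  "lcount (UNd M) = (if size (image_mset lcount M) = 0 then 1 else sum_mset (image_mset lcount M))"

text \<open>Leaves of a rooted tree: the non-root vertices without children.\<close>
definition nleaves :: "utree \<Rightarrow> nat" where
  "nleaves t = (case t of UNd M \<Rightarrow> sum_mset (image_mset lcount M))"

text \<open>A subtree below a non-root vertex has no vertex of degree two
(a non-root vertex has degree two iff it has exactly one child).\<close>
primrec nodeg2 :: "utree \<Rightarrow> bool" where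
  "nodeg2 (UNd M) = (size (image_mset nodeg2 M) \<noteq> 1 \<and> (\<forall>b\<in>#image_mset nodeg2 M. b))"

text \<open>Binary below a non-root vertex: every non-leaf vertex has degree three
(two children).\<close>
primrec binsub :: "utree \<Rightarrow> bool" where
  "binsub (UNd M) = (size (image_mset binsub M) = 0
                     \<or> (size (image_mset binsub M) = 2 \<and> (\<forall>b\<in>#image_mset binsub M. b)))"

definition Tn_o :: "nat \<Rightarrow> utree set" where
  "Tn_o n = {t. nleaves t = n \<and> (case t of UNd M \<Rightarrow> (\<forall>s\<in>#M. nodeg2 s))}"

definition Tn_bo :: "nat \<Rightarrow> utree set" where
  "Tn_bo n = {t \<in> Tn_o n. case t of UNd M \<Rightarrow> size M = 1 \<and> (\<forall>s\<in>#M. binsub s)}"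

datatype otree = ONd "otree list"

fun shape :: "otree \<Rightarrow> utree" where
  "shape (ONd ts) = UNd (mset (map shape ts))"

definition rep :: "utree \<Rightarrow> otree" where
  "rep u = (SOME T. shape T = u)"

text \<open>Vertices are addressed by paths (lists of child indices) from the root.\<close>
fun ispos :: "otree \<Rightarrow> nat list \<Rightarrow> bool" where
  "ispos T [] = True"
| "ispos (ONd ts) (i # p) = (i < length ts \<and> ispos (ts ! i) p)"

fun sub :: "otree \<Rightarrow> nat list \<Rightarrow> otree" where
  "sub T [] = T"
| "sub (ONd ts) (i # p) = sub (ts ! i) p"

fun repl :: "otree \<Rightarrow> nat list \<Rightarrow> otree \<Rightarrow> otree" where
  "repl T [] S = S"
| "repl (ONd ts) (i # p) S = ONd (ts[i := repl (ts ! i) p S])"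

definition nch :: "otree \<Rightarrow> nat list \<Rightarrow> nat" where
  "nch T p = (case sub T p of ONd ts \<Rightarrow> length ts)"

definition isleaf :: "otree \<Rightarrow> nat list \<Rightarrow> bool" where
  "isleaf T p \<longleftrightarrow> ispos T p \<and> p \<noteq> [] \<and> nch T p = 0"

text \<open>Edges are identified with their lower endpoint (any non-root vertex).\<close>
definition edges :: "otree \<Rightarrow> nat list set" where
  "edges T = {p. ispos T p \<and> p \<noteq> []}"

text \<open>Step (i): the edge \<open>u \<rightarrow> v\<close> is replaced by \<open>u \<rightarrow> w, w \<rightarrow> v, w \<rightarrow> \<ell>\<close>.\<close>
definition graft :: "otree \<Rightarrow> nat list \<Rightarrow> otree" where
  "graft T v = repl T v (ONd [sub T v, ONd []])"

fun lcp :: "nat list \<Rightarrow> nat list \<Rightarrow> nat list" where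
  "lcp (x # xs) (y # ys) = (if x = y then x # lcp xs ys else [])"
| "lcp _ _ = []"

text \<open>Vertices of the reduced tree \<open>\<R>\<^sub>2\<close> spanned by the root and leaves \<open>a\<close>, \<open>b\<close>.\<close>
definition inR2 :: "nat list \<Rightarrow> nat list \<Rightarrow> nat list \<Rightarrow> bool" where
  "inR2 a b p \<longleftrightarrow> take (length p) a = p \<or> take (length p) b = p"

text \<open>Projection \<open>\<pi>\<^sup>\<R>\<^sup>2\<close>: farthest point from the root of the path to \<open>p\<close> lying in \<open>\<R>\<^sub>2\<close>.\<close>
definition projR2 :: "nat list \<Rightarrow> nat list \<Rightarrow> nat list \<Rightarrow> nat list" where
  "projR2 a b p = (if length (lcp p a) \<ge> length (lcp p b) then lcp p a else lcp p b)"

text \<open>The subtrees \<open>\<S>\<^sub>x\<close> hanging at \<open>x \<in> \<R>\<^sub>2\<close>, given as the list of subtrees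
rooted at the children of \<open>x\<close> not lying in \<open>\<R>\<^sub>2\<close>.\<close>
definition hang :: "otree \<Rightarrow> nat list \<Rightarrow> nat list \<Rightarrow> nat list \<Rightarrow> otree list" where
  "hang T a b x = (case sub T x of ONd ts \<Rightarrow>
     map snd (filter (\<lambda>(i, s). \<not> inR2 a b (x @ [i])) (zip [0..<length ts] ts)))"

text \<open>A branch is given by a path \<open>P\<close> and a bound \<open>h\<close>: its vertices are the
prefixes \<open>take k P\<close>; with current cut state \<open>c\<close> the remaining part consists of
those with \<open>c \<le> k < h\<close>.\<close>
definition inbr :: "nat list \<times> nat \<Rightarrow> nat \<Rightarrow> nat list \<Rightarrow> bool" where
  "inbr B c y \<longleftrightarrow> c \<le> length y \<and> length y < snd B \<and> y = take (length y) (fst B)"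

text \<open>The cutting procedure: processes the points \<open>Y\<^sub>2, Y\<^sub>3, \<dots>\<close> in label order and
returns the blocks \<open>B\<^sub>1, B\<^sub>2, \<dots>\<close> (each as the list of its vertices, in branch order).\<close>
fun cutblocks :: "(nat list \<times> nat) list \<Rightarrow> nat list \<Rightarrow> nat list list \<Rightarrow> nat list list list" where
  "cutblocks Bs c [] = []"
| "cutblocks Bs c (y # ys) =
     (case find (\<lambda>i. inbr (Bs ! i) (c ! i) y) [0..<length Bs] of
        None \<Rightarrow> cutblocks Bs c ys
      | Some i \<Rightarrow> map (\<lambda>k. take k (fst (Bs ! i))) [c ! i..<Suc (length y)]
                  # cutblocks Bs (c[i := Suc (length y)]) ys)"

text \<open>Building the new spine: a list of spine vertices, each given by the list of
subtrees hanging there. Starts with the new root (nothing hanging). A block whose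
first vertex is a start point (\<open>\<rho>\<close> or \<open>\<Omega>\<close>) gets that vertex identified with the
previous spine vertex (the hanging subtrees are joined at their roots).\<close>
fun glue :: "(nat list \<Rightarrow> otree list) \<Rightarrow> nat list set \<Rightarrow> otree list list
              \<Rightarrow> nat list list list \<Rightarrow> otree list list" where
  "glue h St sp [] = sp"
| "glue h St sp (bl # bls) =
     glue h St (case bl of [] \<Rightarrow> sp
                 | v # vs \<Rightarrow> if v \<in> St then butlast sp @ [last sp @ h v] @ map h vs
                              else sp @ map h (v # vs)) bls"

text \<open>Turn the spine into a tree; the spine ends in the leaf \<open>\<Sigma>\<^sub>1\<close>.\<close>
fun build :: "otree list list \<Rightarrow> otree" where
  "build [] = ONd []"
| "build (hs # hss) = ONd (hs @ [build hss])"

text \<open>Step (iv): given \<open>T\<^sub>+\<^sub>1\<close>, the leaves \<open>\<Sigma>\<^sub>1 = a\<close>, \<open>\<Sigma>~\<^sub>1 = b\<close>, and the list \<open>\<sigma>\<close>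
with \<open>\<sigma> ! (j - 2)\<close> the leaf labelled \<open>j\<close>, the resulting tree.\<close>
definition newtree :: "otree \<Rightarrow> nat list \<Rightarrow> nat list \<Rightarrow> nat list list \<Rightarrow> otree" where
  "newtree T a b \<sigma> =
     (let \<Omega> = lcp a b;
          Bs = [(\<Omega>, length \<Omega>), (a, length a), (b, length b)];
          c0 = [0, Suc (length \<Omega>), length \<Omega>];
          ys = map (projR2 a b) \<sigma>;
          blocks = cutblocks Bs c0 ys
      in build (glue (hang T a b) {[], \<Omega>} [[]] blocks))"

definition step :: "utree \<Rightarrow> utree pmf" where
  "step u = (let T = rep u in
     bind_pmf (pmf_of_set (edges T)) (\<lambda>v.
       let T' = graft T v in
       bind_pmf (pmf_of_set {(a, b). isleaf T' a \<and> isleaf T' b \<and> a \<noteq> b}) (\<lambda>(a, b).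
         bind_pmf (pmf_of_set (permutations_of_set ({p. isleaf T' p} - {a, b}))) (\<lambda>\<sigma>.
           return_pmf (shape (newtree T' a b \<sigma>))))))"

definition law :: "utree pmf \<Rightarrow> nat \<Rightarrow> utree pmf" where
  "law \<mu> k = ((\<lambda>\<nu>. bind_pmf \<nu> step) ^^ k) \<mu>"

definition accessible :: "utree \<Rightarrow> utree \<Rightarrow> bool" where
  "accessible x y \<longleftrightarrow> (x, y) \<in> {(x, y). y \<in> set_pmf (step x)}\<^sup>*"

definition closed_comm_class :: "nat \<Rightarrow> utree set \<Rightarrow> bool" where
  "closed_comm_class n C \<longleftrightarrow>
     C \<noteq> {} \<and> C \<subseteq> Tn_o n
     \<and> (\<forall>x\<in>C. \<forall>y\<in>C. accessible x y)
     \<and> (\<forall>x\<in>C. \<forall>y\<in>Tn_o n. accessible x y \<and> accessible y x \<longrightarrow> y \<in> C)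
     \<and> (\<forall>x\<in>C. set_pmf (step x) \<subseteq> C)"

definition stationary :: "nat \<Rightarrow> utree pmf \<Rightarrow> bool" where
  "stationary n \<pi> \<longleftrightarrow> set_pmf \<pi> \<subseteq> Tn_o n \<and> bind_pmf \<pi> step = \<pi>"

end

(* Every accessibility statement is obtained from one kind of transition. Let Omega be a vertex
   with two distinct children spanning subtrees A and B. Insert the new leaf on an edge of B and
   select it as the leaf to be lost, select Sigma_1 in A, and let the first labels sit at the last
   vertices of the branches E_1, E_3, E_2, in this order, so that each branch is one block. The
   result is the old tree with A planted on the chosen edge of B, where Omega has disappeared and
   its other subtrees have moved to its parent (if Omega is the root, it survives).

   Applied at vertices with more than two children, such moves push the surplus subtrees up to the
   root, where they are merged one by one: a binary tree is reached. Planting turns every binary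
   tree into the caterpillar, and the caterpillar into every binary tree with the same number of
   leaves. Planting A on the edge leading into B changes nothing, so the caterpillar is also
   reached from all states at one common time, and a contraction argument finishes the proof. *)

theory Submission
  imports Defs
begin

section \<open>Moves on unordered trees\<close>

text \<open>The order E_1, E_3, E_2 is dictated by the place of Omega. It is the start point of E_3,
  so the block of E_3, coming second, is joined at Omega to the last vertex of E_1, the parent of
  Omega. This block ends in the vertex created by the insertion, which carries the old subtree below
  the chosen edge; E_2 with Sigma_1, that is A, then continues where the lost leaf was attached. A
  branch becomes one block only if something hangs at its last vertex, since otherwise no label is
  projected there. Away from the root and Omega this is what the absence of vertices of degree two
  provides. A root at which nothing hangs needs separate care: the bare root with which
  \<open>glue\<close> starts takes its place. \<open>step\<close> works in one unspecified planar
  representative. The moves are therefore stated for multisets, where the combinatorics is easy, and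
  then translated into paths of whichever representative was chosen; the outcome of a transition is
  compared with that of a move only through \<open>shape\<close>.\<close>

lemma lcount_UNd: "lcount (UNd M) = (if M = {#} then 1 else sum_mset (image_mset lcount M))"
  by simp

declare lcount.simps [simp del]

lemma lcount_pos: "lcount s > 0"
proof (induction s)
  case (UNd M)
  show ?case
  proof (cases "M = {#}")
    case False
    then obtain x N where "M = add_mset x N" by (meson multiset_cases)
    then show ?thesis using UNd by (auto simp: lcount_UNd)
  qed (auto simp: lcount_UNd)
qed

lemma nodeg2_UNd: "nodeg2 (UNd M) \<longleftrightarrow> size M \<noteq> 1 \<and> (\<forall>s\<in>#M. nodeg2 s)"
  by auto

lemma binsub_UNd: "binsub (UNd M) \<longleftrightarrow> M = {#} \<or> (size M = 2 \<and> (\<forall>s\<in>#M. binsub s))"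
  by auto

declare nodeg2.simps [simp del] binsub.simps [simp del]

lemma binsub_pair: "binsub (UNd {#A, B#}) \<longleftrightarrow> binsub A \<and> binsub B"
  by (simp add: binsub_UNd)

lemma lcount_pair: "lcount (UNd {#A, B#}) = lcount A + lcount B"
  by (simp add: lcount_UNd)

lemma size2_obtain:
  assumes "size M \<ge> 2" obtains A B H where "M = add_mset A (add_mset B H)"
proof -
  from assms obtain A M' where 1: "M = add_mset A M'" by (cases M) auto
  with assms obtain B H where "M' = add_mset B H" by (cases M') auto
  with 1 show thesis using that by blast
qed

lemma binsub_cases [consumes 1, case_names leaf pair]:
  assumes "binsub s"
  obtains "s = UNd {#}" | A B where "s = UNd {#A, B#}" "binsub A" "binsub B"
proof (cases s)
  case (UNd M)
  show thesis
  proof (cases "M = {#}")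
    case True then show thesis using that(1) UNd by simp
  next
    case False
    then have "size M = 2" using assms UNd by (auto simp: binsub_UNd)
    moreover from this obtain A B H where "M = add_mset A (add_mset B H)"
      using size2_obtain[of M] by auto
    ultimately obtain A B where "M = {#A, B#}" by auto
    then show thesis using that(2) assms UNd by (auto simp: binsub_pair)
  qed
qed

text \<open>In \<open>ins A B X\<close> the tree \<open>A\<close> is planted on an edge of \<open>B\<close>; the case \<open>top\<close> is the edge
  leading into the root of \<open>B\<close>.\<close>

inductive ins :: "utree \<Rightarrow> utree \<Rightarrow> utree \<Rightarrow> bool" for A where
  top: "ins A B (UNd {#A, B#})"
| down: "ins A s s' \<Longrightarrow> ins A (UNd (add_mset s H)) (UNd (add_mset s' H))"

text \<open>The multisets are the collections of subtrees hanging at one vertex. In \<open>loc\<close> the child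
  \<open>\<Omega>\<close> of that vertex disappears and its remaining subtrees \<open>H\<close> pass to the parent; at the root
  (last disjunct of \<open>rmove\<close>) there is no parent and they stay.\<close>

inductive move :: "utree multiset \<Rightarrow> utree multiset \<Rightarrow> bool" where
  loc: "ins A B X \<Longrightarrow> move (add_mset (UNd (add_mset A (add_mset B H))) G) (add_mset X (H + G))"
| cong: "move M M' \<Longrightarrow> move (add_mset (UNd M) G) (add_mset (UNd M') G)"

definition rmove :: "utree multiset \<Rightarrow> utree multiset \<Rightarrow> bool" where
  "rmove M M' \<longleftrightarrow> move M M' \<or>
     (\<exists>A B H X. ins A B X \<and> M = add_mset A (add_mset B H) \<and> M' = add_mset X H)"

lemma move_frame: "move M M' \<Longrightarrow> move (M + F) (M' + F)"
proof (induction rule: move.induct)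
  case (loc A B X H G)
  then show ?case using move.loc[of A B X H "G + F"] by (simp add: add.assoc)
next
  case (cong M M' G)
  then show ?case using move.cong[of M M' "G + F"] by simp
qed

lemma moves_frame: "move\<^sup>*\<^sup>* M M' \<Longrightarrow> move\<^sup>*\<^sup>* (M + F) (M' + F)"
  by (induction rule: rtranclp_induct) (auto intro: move_frame rtranclp.rtrancl_into_rtrancl)

lemma moves_cong: "move\<^sup>*\<^sup>* M M' \<Longrightarrow> move\<^sup>*\<^sup>* (add_mset (UNd M) G) (add_mset (UNd M') G)"
  by (induction rule: rtranclp_induct) (auto intro: move.cong rtranclp.rtrancl_into_rtrancl)

lemma moves_pair: "move\<^sup>*\<^sup>* {#A#} {#A'#} \<Longrightarrow> move\<^sup>*\<^sup>* {#A, B#} {#A', B#}"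
  using moves_frame[of "{#A#}" "{#A'#}" "{#B#}"] by (simp add: add_mset_commute)

lemma moves_add: "move\<^sup>*\<^sup>* M M' \<Longrightarrow> move\<^sup>*\<^sup>* N N' \<Longrightarrow> move\<^sup>*\<^sup>* (M + N) (M' + N')"
  by (metis moves_frame add.commute rtranclp_trans)

text \<open>The result is a forest because resolving a vertex releases its surplus subtrees to the
  parent. The children are treated before the vertex itself; their number never drops, so at least
  two trees remain, and one move with \<open>top\<close> joins two of them and releases the
  others.\<close>

lemma moves_to_binary:
  assumes "nodeg2 s"
  shows "\<exists>F. move\<^sup>*\<^sup>* {#s#} F \<and> F \<noteq> {#} \<and> (\<forall>f\<in>#F. binsub f)"
  using assms
proof (induction s)
  case (UNd M)
  show ?case
  proof (cases "M = {#}")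
    case True
    then show ?thesis by (intro exI[of _ "{#UNd M#}"]) (auto simp: binsub_UNd)
  next
    case False
    have "\<exists>M1. move\<^sup>*\<^sup>* N M1 \<and> size N \<le> size M1 \<and> (\<forall>f\<in>#M1. binsub f)" if "N \<subseteq># M" for N
      using that
    proof (induction N)
      case empty then show ?case by (intro exI[of _ "{#}"]) auto
    next
      case (add x N)
      then obtain M1 where M1: "move\<^sup>*\<^sup>* N M1" "size N \<le> size M1" "\<forall>f\<in>#M1. binsub f"
        by (metis add_mset_add_single subset_mset.order_trans mset_subset_eq_add_left)
      have "x \<in># M" using add.prems by (meson mset_subset_eqD union_single_eq_member)
      then obtain F where F: "move\<^sup>*\<^sup>* {#x#} F" "F \<noteq> {#}" "\<forall>f\<in>#F. binsub f"
        using UNd.IH[of x] UNd.prems by (auto simp: nodeg2_UNd)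
      have "size F \<ge> 1" using F(2) by (simp add: Suc_leI nonempty_has_size)
      then show ?case using moves_add[OF F(1) M1(1)] M1 F
        by (intro exI[of _ "F + M1"]) auto
    qed
    then obtain M1 where M1: "move\<^sup>*\<^sup>* M M1" "size M \<le> size M1" "\<forall>f\<in>#M1. binsub f" by blast
    have "size M \<noteq> 1" "size M \<noteq> 0" using UNd.prems False by (auto simp: nodeg2_UNd)
    then have "size M1 \<ge> 2" using M1 by linarith
    then obtain A B H where H: "M1 = add_mset A (add_mset B H)" by (rule size2_obtain)
    have "move\<^sup>*\<^sup>* {#UNd M#} {#UNd M1#}" using moves_cong[OF M1(1)] .
    moreover have "move {#UNd M1#} (add_mset (UNd {#A, B#}) H)"
      using move.loc[OF ins.top, of A B H "{#}"] H by simp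
    ultimately show ?thesis using M1(3) H
      by (intro exI[of _ "add_mset (UNd {#A, B#}) H"]) (auto simp: binsub_pair)
  qed
qed

lemma rmoves_to_binary:
  assumes "M \<noteq> {#}" "\<forall>s\<in>#M. nodeg2 s"
  shows "\<exists>s. rmove\<^sup>*\<^sup>* M {#s#} \<and> binsub s"
proof -
  have "\<exists>M1. move\<^sup>*\<^sup>* M M1 \<and> (M \<noteq> {#} \<longrightarrow> M1 \<noteq> {#}) \<and> (\<forall>f\<in>#M1. binsub f)"
    using assms(2)
  proof (induction M)
    case empty then show ?case by (intro exI[of _ "{#}"]) auto
  next
    case (add x N)
    then obtain M1 where M1: "move\<^sup>*\<^sup>* N M1" "\<forall>f\<in>#M1. binsub f" by auto
    from add.prems obtain F where F: "move\<^sup>*\<^sup>* {#x#} F" "F \<noteq> {#}" "\<forall>f\<in>#F. binsub f"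
      using moves_to_binary[of x] by auto
    then show ?case using moves_add[OF F(1) M1(1)] M1 F
      by (intro exI[of _ "F + M1"]) auto
  qed
  then obtain M1 where M1: "move\<^sup>*\<^sup>* M M1" "M1 \<noteq> {#}" "\<forall>f\<in>#M1. binsub f" using assms by auto
  have "move \<le> rmove" by (auto simp: rmove_def)
  then have 1: "rmove\<^sup>*\<^sup>* M M1" using M1(1) by (meson rtranclp_mono rev_predicate2D)
  have "\<exists>s. rmove\<^sup>*\<^sup>* N {#s#} \<and> binsub s" if "N \<noteq> {#}" "\<forall>f\<in>#N. binsub f" for N
    using that
  proof (induction "size N" arbitrary: N rule: less_induct)
    case less
    show ?case
    proof (cases "size N \<ge> 2")
      case False
      moreover have "size N \<noteq> 0" using less.prems by simp
      ultimately have "size N = 1" by linarith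
      then obtain s where "N = {#s#}" using size_1_singleton_mset by blast
      then show ?thesis using less.prems by auto
    next
      case True
      then obtain A B H where H: "N = add_mset A (add_mset B H)" by (rule size2_obtain)
      have "rmove N (add_mset (UNd {#A, B#}) H)"
        unfolding rmove_def H using ins.top by blast
      moreover obtain s where "rmove\<^sup>*\<^sup>* (add_mset (UNd {#A, B#}) H) {#s#}" "binsub s"
        using less.hyps[of "add_mset (UNd {#A, B#}) H"] less.prems
        by (auto simp: H binsub_pair)
      ultimately show ?thesis by (meson converse_rtranclp_into_rtranclp)
    qed
  qed
  then show ?thesis using 1 M1 by (meson rtranclp_trans)
qed

section \<open>Binary trees and the caterpillar\<close>

primrec comb :: "nat \<Rightarrow> utree" where
  "comb 0 = UNd {#}"
| "comb (Suc k) = UNd {#UNd {#}, comb k#}"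

lemma lcount_comb: "lcount (comb k) = Suc k"
  by (induction k) (auto simp: lcount_UNd)

lemma binsub_comb: "binsub (comb k)"
  by (induction k) (auto simp: binsub_UNd)

text \<open>The planting edge is the one above the bottom leaf of \<open>comb q\<close>: that leaf
  becomes one more tooth, and \<open>comb p\<close> continues the spine below it.\<close>

lemma ins_comb: "ins (comb p) (comb q) (comb (Suc (p + q)))"
proof (induction q)
  case 0
  show ?case using ins.top[of "comb p" "UNd {#}"] by (simp add: add_mset_commute)
next
  case (Suc q)
  show ?case using ins.down[OF Suc, of "{#UNd {#}#}"] by (simp add: add_mset_commute)
qed

lemma move_ins: "ins A B X \<Longrightarrow> move {#UNd {#A, B#}#} {#X#}"
  using move.loc[of A B X "{#}" "{#}"] by simp

lemma moves_to_comb: "binsub s \<Longrightarrow> move\<^sup>*\<^sup>* {#s#} {#comb (lcount s - 1)#}"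
proof (induction s)
  case (UNd M)
  from UNd.prems show ?case
  proof (cases rule: binsub_cases)
    case leaf then show ?thesis by (simp add: lcount_UNd)
  next
    case (pair A B)
    let ?A = "comb (lcount A - 1)" and ?B = "comb (lcount B - 1)"
    have "move\<^sup>*\<^sup>* {#A#} {#?A#}" "move\<^sup>*\<^sup>* {#B#} {#?B#}" using UNd.IH pair by auto
    then have "move\<^sup>*\<^sup>* {#A, B#} {#?A, ?B#}" using moves_add by fastforce
    then have "move\<^sup>*\<^sup>* {#UNd {#A, B#}#} {#UNd {#?A, ?B#}#}" by (rule moves_cong)
    moreover have "move {#UNd {#?A, ?B#}#} {#comb (Suc ((lcount A - 1) + (lcount B - 1)))#}"
      by (intro move_ins ins_comb)
    moreover have "Suc ((lcount A - 1) + (lcount B - 1)) = lcount (UNd {#A, B#}) - 1"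
      using lcount_pos[of A] lcount_pos[of B] by (simp add: lcount_pair)
    ultimately show ?thesis using pair by (metis rtranclp.rtrancl_into_rtrancl)
  qed
qed

text \<open>The leaf is taken from the first subtree as long as that has two leaves. Once it is a
  single leaf, removing it leaves its sibling, and \<open>top\<close> puts it back.\<close>

lemma binsub_remove_leaf:
  assumes "binsub A" "lcount A \<ge> 2"
  shows "\<exists>A'. binsub A' \<and> lcount A = Suc (lcount A') \<and> ins (UNd {#}) A' A"
  using assms
proof (induction A)
  case (UNd M)
  from UNd.prems(1) show ?case
  proof (cases rule: binsub_cases)
    case leaf then show ?thesis using UNd.prems by (simp add: lcount_UNd)
  next
    case (pair B C)
    show ?thesis
    proof (cases "lcount B \<ge> 2")
      case True
      then obtain B' where B': "binsub B'" "lcount B = Suc (lcount B')" "ins (UNd {#}) B' B"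
        using UNd.IH pair by auto
      then have "ins (UNd {#}) (UNd {#B', C#}) (UNd {#B, C#})" by (intro ins.down)
      then show ?thesis using B' pair by (metis binsub_pair lcount_pair add_Suc)
    next
      case False
      then have "lcount B = 1" using lcount_pos[of B] by linarith
      moreover have "B = UNd {#}" using \<open>binsub B\<close>
      proof (cases rule: binsub_cases)
        case (pair X Y)
        then show ?thesis using False lcount_pos[of X] lcount_pos[of Y] by (simp add: lcount_pair)
      qed
      ultimately show ?thesis using pair ins.top[of "UNd {#}" C]
        by (intro exI[of _ C]) (auto simp: lcount_UNd)
    qed
  qed
qed

text \<open>The top tooth of the comb is kept in reserve while the other leaves are rearranged, by
  induction, into \<open>s\<close> with one leaf missing; planting the reserved leaf completes
  \<open>s\<close>. If the first subtree of \<open>s\<close> is a single leaf, the tooth already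
  stands in its place.\<close>

lemma moves_from_comb: "binsub s \<Longrightarrow> move\<^sup>*\<^sup>* {#comb (lcount s - 1)#} {#s#}"
proof (induction "lcount s" arbitrary: s rule: less_induct)
  case less
  from less.prems show ?case
  proof (cases rule: binsub_cases)
    case leaf then show ?thesis by (simp add: lcount_UNd)
  next
    case (pair A B)
    \<comment> \<open>\<open>comb ?m\<close> carries all leaves but the reserved tooth.\<close>
    let ?m = "lcount A + lcount B - 2"
    have pos: "lcount A > 0" "lcount B > 0" by (rule lcount_pos)+
    have s: "comb (lcount s - 1) = UNd {#UNd {#}, comb ?m#}"
    proof -
      have "lcount s - 1 = Suc ?m" using pos pair by (simp add: lcount_pair)
      then show ?thesis by simp
    qed
    show ?thesis
    proof (cases "lcount A \<ge> 2")
      case True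
      then obtain A' where A': "binsub A'" "lcount A = Suc (lcount A')" "ins (UNd {#}) A' A"
        using binsub_remove_leaf pair by blast
      have "move\<^sup>*\<^sup>* {#comb (lcount (UNd {#A', B#}) - 1)#} {#UNd {#A', B#}#}"
        by (rule less.hyps) (use pair A' in \<open>auto simp: lcount_pair binsub_pair\<close>)
      moreover have "lcount (UNd {#A', B#}) - 1 = ?m" using A' by (simp add: lcount_pair)
      ultimately have "move\<^sup>*\<^sup>* {#comb ?m#} {#UNd {#A', B#}#}" by simp
      then have "move\<^sup>*\<^sup>* {#comb ?m, UNd {#}#} {#UNd {#A', B#}, UNd {#}#}"
        by (rule moves_pair)
      then have "move\<^sup>*\<^sup>* {#comb (lcount s - 1)#} {#UNd {#UNd {#}, UNd {#A', B#}#}#}"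
        unfolding s using moves_cong[of _ _ "{#}"] by (simp add: add_mset_commute)
      moreover have "move {#UNd {#UNd {#}, UNd {#A', B#}#}#} {#s#}"
        unfolding pair(1) by (intro move_ins ins.down A')
      ultimately show ?thesis by (rule rtranclp.rtrancl_into_rtrancl)
    next
      case False
      have "A = UNd {#}" using \<open>binsub A\<close>
      proof (cases rule: binsub_cases)
        case (pair X Y)
        then show ?thesis using False lcount_pos[of X] lcount_pos[of Y] by (simp add: lcount_pair)
      qed
      moreover have "move\<^sup>*\<^sup>* {#comb (lcount B - 1)#} {#B#}"
        by (rule less.hyps) (use pair in \<open>auto simp: lcount_pair lcount_pos\<close>)
      then have "move\<^sup>*\<^sup>* {#comb (lcount B - 1), UNd {#}#} {#B, UNd {#}#}"
        by (rule moves_pair)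
      then have "move\<^sup>*\<^sup>* {#UNd {#comb (lcount B - 1), UNd {#}#}#} {#UNd {#B, UNd {#}#}#}"
        by (rule moves_cong)
      moreover have "?m = lcount B - 1" using False pos by linarith
      ultimately show ?thesis unfolding s unfolding pair(1) by (simp add: add_mset_commute)
    qed
  qed
qed

section \<open>Convergence of finite chains\<close>

definition kpow :: "('a \<Rightarrow> 'a pmf) \<Rightarrow> nat \<Rightarrow> 'a \<Rightarrow> 'a pmf" where
  "kpow K k x = ((\<lambda>\<nu>. bind_pmf \<nu> K) ^^ k) (return_pmf x)"

lemma funpow_bind_pmf: "((\<lambda>\<nu>. bind_pmf \<nu> K) ^^ k) \<mu> = bind_pmf \<mu> (kpow K k)"
proof (induction k)
  case 0 then show ?case by (simp add: kpow_def bind_return_pmf')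
next
  case (Suc k)
  then show ?case by (simp add: kpow_def bind_assoc_pmf)
qed

lemma kpow_0: "kpow K 0 x = return_pmf x" by (simp add: kpow_def)

lemma kpow_add: "kpow K (m + k) x = bind_pmf (kpow K m x) (kpow K k)"
proof -
  have "kpow K (m + k) x = ((\<lambda>\<nu>. bind_pmf \<nu> K) ^^ k) (kpow K m x)"
    by (simp add: kpow_def add.commute[of m k] funpow_add)
  then show ?thesis by (simp add: funpow_bind_pmf)
qed

lemma kpow_Suc: "kpow K (Suc k) x = bind_pmf (kpow K k x) K"
  by (simp add: kpow_def)

lemma set_kpow_subset:
  assumes "\<And>x. x \<in> S \<Longrightarrow> set_pmf (K x) \<subseteq> S" "x \<in> S"
  shows "set_pmf (kpow K k x) \<subseteq> S"
proof (induction k)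
  case 0
  show ?case using assms(2) by (simp add: kpow_0)
next
  case (Suc k)
  then show ?case using assms(1) by (fastforce simp: kpow_Suc)
qed

lemma rtrancl_kpow:
  "(x, y) \<in> {(x, y). y \<in> set_pmf (K x)}\<^sup>* \<Longrightarrow> \<exists>k. y \<in> set_pmf (kpow K k x)"
proof (induction rule: rtrancl_induct)
  case base show ?case by (intro exI[of _ 0]) (simp add: kpow_0)
next
  case (step y z)
  then obtain k where "y \<in> set_pmf (kpow K k x)" by blast
  with step show ?case by (intro exI[of _ "Suc k"]) (auto simp: kpow_Suc)
qed

lemma pmf_bind_finite:
  assumes "finite S" "set_pmf p \<subseteq> S"
  shows "pmf (bind_pmf p f) y = (\<Sum>z\<in>S. pmf p z * pmf (f z) y)"
proof -
  have "pmf (bind_pmf p f) y = measure_pmf.expectation p (\<lambda>z. pmf (f z) y)"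
    by (rule pmf_bind)
  also have "\<dots> = (\<Sum>z\<in>S. pmf (f z) y * pmf p z)"
    by (rule integral_measure_pmf_real) (use assms in auto)
  finally show ?thesis by (simp add: mult.commute)
qed

text \<open>A finite chain with a state reached from everywhere at one common time \<open>N\<close>: the
  oscillation of \<open>x \<mapsto> P\<^sup>k(x, y)\<close> over \<open>S\<close> shrinks by a constant factor every \<open>N\<close> steps.\<close>

locale doeblin_chain =
  fixes K :: "'a \<Rightarrow> 'a pmf" and S :: "'a set" and t :: 'a and N :: nat
  assumes fin: "finite S" and tS: "t \<in> S"
    and closed: "\<And>x. x \<in> S \<Longrightarrow> set_pmf (K x) \<subseteq> S"
    and reach: "\<And>x. x \<in> S \<Longrightarrow> t \<in> set_pmf (kpow K N x)"
begin

lemma set_kpow: "x \<in> S \<Longrightarrow> set_pmf (kpow K k x) \<subseteq> S"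
  using closed by (rule set_kpow_subset)

definition hi :: "'a \<Rightarrow> nat \<Rightarrow> real" where "hi y k = Max ((\<lambda>x. pmf (kpow K k x) y) ` S)"
definition lo :: "'a \<Rightarrow> nat \<Rightarrow> real" where "lo y k = Min ((\<lambda>x. pmf (kpow K k x) y) ` S)"

lemma le_hi: "x \<in> S \<Longrightarrow> pmf (kpow K k x) y \<le> hi y k"
  unfolding hi_def using fin by (intro Max_ge) auto

lemma lo_le: "x \<in> S \<Longrightarrow> lo y k \<le> pmf (kpow K k x) y"
  unfolding lo_def using fin by (intro Min_le) auto

lemma hi_le: "(\<And>x. x \<in> S \<Longrightarrow> pmf (kpow K k x) y \<le> c) \<Longrightarrow> hi y k \<le> c"
  unfolding hi_def using fin tS by (subst Max_le_iff) auto

lemma le_lo: "(\<And>x. x \<in> S \<Longrightarrow> c \<le> pmf (kpow K k x) y) \<Longrightarrow> c \<le> lo y k"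
  unfolding lo_def using fin tS by (subst Min_ge_iff) auto

lemma sum_kpow: "x \<in> S \<Longrightarrow> (\<Sum>z\<in>S. pmf (kpow K m x) z) = 1"
  using fin by (intro sum_pmf_eq_1 set_kpow) auto

lemma kpow_split: "x \<in> S \<Longrightarrow>
  pmf (kpow K (m + k) x) y = (\<Sum>z\<in>S. pmf (kpow K m x) z * pmf (kpow K k z) y)"
  by (subst kpow_add) (rule pmf_bind_finite[OF fin set_kpow])

text \<open>Conditioning on the state after m steps, a mass e sits at t whatever x is, and the rest
  is bounded by the worst starting point. With e = 0 this yields monotonicity of \<open>hi\<close>;
  with a positive e valid for all x it yields the contraction.\<close>

lemma upper:
  assumes "x \<in> S" "0 \<le> e" "e \<le> pmf (kpow K m x) t"
  shows "pmf (kpow K (m + k) x) y \<le> e * pmf (kpow K k t) y + (1 - e) * hi y k"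
proof -
  let ?q = "\<lambda>z. pmf (kpow K m x) z" and ?p = "\<lambda>z. pmf (kpow K k z) y"
  have "pmf (kpow K (m + k) x) y = ?q t * ?p t + (\<Sum>z\<in>S-{t}. ?q z * ?p z)"
    unfolding kpow_split[OF assms(1)] using fin tS by (subst sum.remove) auto
  also have "(\<Sum>z\<in>S-{t}. ?q z * ?p z) \<le> (\<Sum>z\<in>S-{t}. ?q z * hi y k)"
    by (intro sum_mono mult_left_mono le_hi) auto
  also have "\<dots> = (1 - ?q t) * hi y k"
    using sum_kpow[OF assms(1), of m] fin tS by (simp add: sum.remove sum_distrib_right[symmetric])
  also have "?q t * ?p t + (1 - ?q t) * hi y k = hi y k - ?q t * (hi y k - ?p t)"
    by (simp add: algebra_simps)
  also have "\<dots> \<le> hi y k - e * (hi y k - ?p t)"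
    using le_hi[OF tS, of k y] assms by (simp add: mult_right_mono)
  finally show ?thesis by (simp add: algebra_simps)
qed

lemma lower:
  assumes "x \<in> S" "0 \<le> e" "e \<le> pmf (kpow K m x) t"
  shows "e * pmf (kpow K k t) y + (1 - e) * lo y k \<le> pmf (kpow K (m + k) x) y"
proof -
  let ?q = "\<lambda>z. pmf (kpow K m x) z" and ?p = "\<lambda>z. pmf (kpow K k z) y"
  have "e * (?p t - lo y k) \<le> ?q t * (?p t - lo y k)"
    using lo_le[OF tS, of y k] assms by (simp add: mult_right_mono)
  then have "e * ?p t + (1 - e) * lo y k \<le> ?q t * ?p t + (1 - ?q t) * lo y k"
    by (simp add: algebra_simps)
  also have "(1 - ?q t) * lo y k = (\<Sum>z\<in>S-{t}. ?q z * lo y k)"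
    using sum_kpow[OF assms(1), of m] fin tS by (simp add: sum.remove sum_distrib_right[symmetric])
  also have "\<dots> \<le> (\<Sum>z\<in>S-{t}. ?q z * ?p z)"
    by (intro sum_mono mult_left_mono lo_le) auto
  also have "?q t * ?p t + (\<Sum>z\<in>S-{t}. ?q z * ?p z) = pmf (kpow K (m + k) x) y"
    unfolding kpow_split[OF assms(1)] using fin tS by (subst (2) sum.remove) auto
  finally show ?thesis by simp
qed

lemma decseq_hi: "decseq (hi y)"
proof (rule decseq_SucI, rule hi_le)
  fix k x assume "x \<in> S"
  then show "pmf (kpow K (Suc k) x) y \<le> hi y k" using upper[of x 0 "Suc 0" k y] by simp
qed

lemma incseq_lo: "incseq (lo y)"
proof (rule incseq_SucI, rule le_lo)
  fix k x assume "x \<in> S"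
  then show "lo y k \<le> pmf (kpow K (Suc k) x) y" using lower[of x 0 "Suc 0" k y] by simp
qed

lemma lo_le_hi: "lo y k \<le> hi y k"
  using lo_le[OF tS] le_hi[OF tS] by (rule order_trans)

lemma hi_lo_limit: "\<exists>l. hi y \<longlonglongrightarrow> l \<and> lo y \<longlonglongrightarrow> l"
proof -
  define e where "e = Min ((\<lambda>x. pmf (kpow K N x) t) ` S)"
  have e: "0 < e" "\<And>x. x \<in> S \<Longrightarrow> e \<le> pmf (kpow K N x) t"
    unfolding e_def using fin tS reach[THEN pmf_positive] by (subst Min_gr_iff, auto)
  \<comment> \<open>The term \<open>e * pmf (kpow K k t) y\<close> occurs in both bounds and cancels
    in the difference.\<close>
  have contract: "hi y (N + k) - lo y (N + k) \<le> (1 - e) * (hi y k - lo y k)" for k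
  proof -
    have "hi y (N + k) \<le> e * pmf (kpow K k t) y + (1 - e) * hi y k"
      using upper e by (intro hi_le) (simp add: less_imp_le)
    moreover have "lo y (N + k) \<ge> e * pmf (kpow K k t) y + (1 - e) * lo y k"
      using lower e by (intro le_lo) (simp add: less_imp_le)
    ultimately show ?thesis by (simp add: algebra_simps)
  qed
  have "lo y 0 \<le> hi y k" for k
    using incseqD[OF incseq_lo[of y], of 0 k] lo_le_hi[of y k] by simp
  then obtain h where h: "hi y \<longlonglongrightarrow> h"
    using decseq_convergent[OF decseq_hi] by blast
  have "lo y k \<le> hi y 0" for k
    using decseqD[OF decseq_hi[of y], of 0 k] lo_le_hi[of y k] by simp
  then obtain l where l: "lo y \<longlonglongrightarrow> l"
    using incseq_convergent[OF incseq_lo] by blast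
  \<comment> \<open>Both limits exist by monotonicity, so the contraction may be passed to the
    limit; as e > 0, it closes the gap between h and l.\<close>
  have "h - l \<le> (1 - e) * (h - l)"
  proof (rule LIMSEQ_le)
    show "(\<lambda>k. hi y (k + N) - lo y (k + N)) \<longlonglongrightarrow> h - l"
      by (intro tendsto_diff LIMSEQ_ignore_initial_segment h l)
    show "(\<lambda>k. (1 - e) * (hi y k - lo y k)) \<longlonglongrightarrow> (1 - e) * (h - l)"
      by (intro tendsto_intros h l)
    show "\<exists>M. \<forall>k\<ge>M. hi y (k + N) - lo y (k + N) \<le> (1 - e) * (hi y k - lo y k)"
      using contract by (simp add: add.commute)
  qed
  then have "e * (h - l) \<le> 0" by (simp add: algebra_simps)
  then have "h \<le> l" using e(1) by (simp add: mult_le_0_iff)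
  moreover have "l \<le> h" using lo_le_hi by (intro LIMSEQ_le[OF l h]) auto
  ultimately show ?thesis using h l by auto
qed

lemma limit_law: "\<exists>\<pi>. set_pmf \<pi> \<subseteq> S \<and> (\<forall>x\<in>S. \<forall>y. (\<lambda>k. pmf (kpow K k x) y) \<longlonglongrightarrow> pmf \<pi> y)"
proof -
  have "\<forall>y. \<exists>l. hi y \<longlonglongrightarrow> l \<and> lo y \<longlonglongrightarrow> l" using hi_lo_limit by blast
  then obtain l where l: "\<And>y. hi y \<longlonglongrightarrow> l y" "\<And>y. lo y \<longlonglongrightarrow> l y" by metis
  have lim: "(\<lambda>k. pmf (kpow K k x) y) \<longlonglongrightarrow> l y" if "x \<in> S" for x y
    by (rule tendsto_sandwich[OF _ _ l(2) l(1)]) (use that le_hi lo_le in auto)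
  have nonneg: "l y \<ge> 0" for y
    by (rule LIMSEQ_le_const[OF lim[OF tS]]) auto
  \<comment> \<open>Finiteness of S keeps mass from escaping, so the limits add up to one.\<close>
  have "(\<lambda>k. \<Sum>y\<in>S. pmf (kpow K k t) y) \<longlonglongrightarrow> (\<Sum>y\<in>S. l y)"
    by (intro tendsto_sum lim tS)
  then have sum1: "(\<Sum>y\<in>S. l y) = 1"
    using LIMSEQ_unique[OF _ tendsto_const] by (simp add: sum_kpow[OF tS])
  have outside: "l y = 0" if "y \<notin> S" for y
  proof -
    have "pmf (kpow K k t) y = 0" for k
      using set_kpow[OF tS] that by (metis set_pmf_iff subsetD)
    then have "(\<lambda>k. 0) \<longlonglongrightarrow> l y" using lim[OF tS, of y] by simp
    then show ?thesis by (simp add: LIMSEQ_const_iff)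
  qed
  have "(\<integral>\<^sup>+y. ennreal (l y) \<partial>count_space UNIV) = (\<Sum>y\<in>S. ennreal (l y))"
    by (rule nn_integral_count_space'[OF fin]) (simp_all add: outside)
  also have "\<dots> = 1" using sum1 by (subst sum_ennreal) (simp_all add: nonneg)
  finally have "pmf (embed_pmf l) y = l y" for y
    by (intro pmf_embed_pmf nonneg)
  then have "pmf (embed_pmf l) = l" by blast
  moreover from this have "set_pmf (embed_pmf l) \<subseteq> S"
    using outside by (metis set_pmf_iff subsetI)
  ultimately show ?thesis using lim by (intro exI[of _ "embed_pmf l"]) simp
qed

text \<open>Pass to the limit in \<open>kpow_Suc\<close>: the sum over states is finite, and the
  shifted sequence has the same limit.\<close>

lemma kpow_limit_stationary:
  assumes "set_pmf \<pi> \<subseteq> S" "\<And>x y. x \<in> S \<Longrightarrow> (\<lambda>k. pmf (kpow K k x) y) \<longlonglongrightarrow> pmf \<pi> y"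
  shows "bind_pmf \<pi> K = \<pi>"
proof (rule pmf_eqI)
  fix y
  have "(\<lambda>k. \<Sum>z\<in>S. pmf (kpow K k t) z * pmf (K z) y) \<longlonglongrightarrow> (\<Sum>z\<in>S. pmf \<pi> z * pmf (K z) y)"
    by (intro tendsto_intros assms tS)
  also have "(\<Sum>z\<in>S. pmf \<pi> z * pmf (K z) y) = pmf (bind_pmf \<pi> K) y"
    by (simp add: pmf_bind_finite[OF fin assms(1)])
  also have "(\<lambda>k. \<Sum>z\<in>S. pmf (kpow K k t) z * pmf (K z) y) = (\<lambda>k. pmf (kpow K (Suc k) t) y)"
    by (simp add: kpow_Suc pmf_bind_finite[OF fin set_kpow[OF tS]])
  finally show "pmf (bind_pmf \<pi> K) y = pmf \<pi> y"
    using LIMSEQ_Suc[OF assms(2)[OF tS]] LIMSEQ_unique by blast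
qed

lemma kpow_limit_mixture:
  assumes "set_pmf \<mu> \<subseteq> S" "\<And>x y. x \<in> S \<Longrightarrow> (\<lambda>k. pmf (kpow K k x) y) \<longlonglongrightarrow> pmf \<pi> y"
  shows "(\<lambda>k. pmf (bind_pmf \<mu> (kpow K k)) y) \<longlonglongrightarrow> pmf \<pi> y"
proof -
  have "(\<lambda>k. \<Sum>z\<in>S. pmf \<mu> z * pmf (kpow K k z) y) \<longlonglongrightarrow> (\<Sum>z\<in>S. pmf \<mu> z * pmf \<pi> y)"
    by (intro tendsto_intros assms)
  also have "(\<Sum>z\<in>S. pmf \<mu> z * pmf \<pi> y) = pmf \<pi> y"
    using sum_pmf_eq_1[OF fin assms(1)] by (simp add: sum_distrib_right[symmetric])
  finally show ?thesis by (simp add: pmf_bind_finite[OF fin assms(1)])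
qed

theorem convergence:
  "\<exists>\<pi>. set_pmf \<pi> \<subseteq> S \<and> bind_pmf \<pi> K = \<pi> \<and>
     (\<forall>\<mu>. set_pmf \<mu> \<subseteq> S \<longrightarrow> (\<forall>y. (\<lambda>k. pmf (bind_pmf \<mu> (kpow K k)) y) \<longlonglongrightarrow> pmf \<pi> y))"
proof -
  obtain \<pi> where \<pi>: "set_pmf \<pi> \<subseteq> S"
    "\<And>x y. x \<in> S \<Longrightarrow> (\<lambda>k. pmf (kpow K k x) y) \<longlonglongrightarrow> pmf \<pi> y"
    using limit_law by blast
  show ?thesis
    using \<pi>(1) kpow_limit_stationary[OF \<pi>] kpow_limit_mixture[OF _ \<pi>(2)] by blast
qed

end

text \<open>The loop at t allows waiting there, so every arrival time can be extended to the largest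
  one; this is how aperiodicity enters.\<close>

lemma exists_common_time:
  assumes fin: "finite S" and acc: "\<And>x. x \<in> S \<Longrightarrow> (x, t) \<in> {(x, y). y \<in> set_pmf (K x)}\<^sup>*"
    and loop: "t \<in> set_pmf (K t)"
  shows "\<exists>N. \<forall>x\<in>S. t \<in> set_pmf (kpow K N x)"
proof -
  have "\<forall>x\<in>S. \<exists>k. t \<in> set_pmf (kpow K k x)" by (intro ballI rtrancl_kpow acc)
  then obtain f where f: "\<And>x. x \<in> S \<Longrightarrow> t \<in> set_pmf (kpow K (f x) x)" by metis
  have stay: "t \<in> set_pmf (kpow K (m + d) x)" if "t \<in> set_pmf (kpow K m x)" for m d x
    using that by (induction d) (auto simp: kpow_Suc intro: loop)
  have "t \<in> set_pmf (kpow K (Max (f ` S)) x)" if "x \<in> S" for x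
  proof -
    have "f x \<le> Max (f ` S)" using fin that by simp
    then show ?thesis using stay[OF f[OF that]] by (metis le_add_diff_inverse)
  qed
  then show ?thesis by blast
qed

section \<open>Finiteness of the state space\<close>

lemma finite_multisets_bounded:
  assumes "finite A" shows "finite {M. set_mset M \<subseteq> A \<and> size M \<le> n}"
proof -
  have "{M. set_mset M \<subseteq> A \<and> size M \<le> n} \<subseteq> mset ` {xs. set xs \<subseteq> A \<and> length xs \<le> n}"
  proof
    fix M assume M: "M \<in> {M. set_mset M \<subseteq> A \<and> size M \<le> n}"
    obtain xs where "mset xs = M" using ex_mset by blast
    with M show "M \<in> mset ` {xs. set xs \<subseteq> A \<and> length xs \<le> n}"
      by (auto intro!: image_eqI[of _ _ xs])
  qed
  then show ?thesis by (rule finite_surj[OF finite_lists_length_le[OF assms]])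
qed

lemma size_le_sum_lcount: "size M \<le> sum_mset (image_mset lcount M)"
proof (induction M)
  case (add x M)
  then show ?case using lcount_pos[of x] by simp
qed auto

text \<open>A vertex with children has at least two of them, and each contains a leaf, so every
  child has strictly fewer leaves than its parent. Chains of vertices with one child would make the
  set infinite.\<close>

lemma finite_nodeg2: "finite {s. nodeg2 s \<and> lcount s \<le> n}"
proof (induction n)
  case 0
  have "{s. nodeg2 s \<and> lcount s \<le> 0} = {}" using lcount_pos by (metis (no_types, lifting) Collect_empty_eq leD)
  then show ?case by (simp only: finite.emptyI)
next
  case (Suc n)
  let ?A = "{s. nodeg2 s \<and> lcount s \<le> n}"
  have "s \<in> UNd ` {M. set_mset M \<subseteq> ?A \<and> size M \<le> Suc n}" if s: "nodeg2 s" "lcount s \<le> Suc n" for s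
  proof (cases s)
    case (UNd M)
    show ?thesis
    proof (cases "M = {#}")
      case False
      then have L: "sum_mset (image_mset lcount M) \<le> Suc n" using s UNd by (simp add: lcount_UNd)
      have "x \<in> ?A" if x: "x \<in># M" for x
      proof -
        obtain N where N: "M = add_mset x N" using multi_member_split[OF x] by blast
        then have "N \<noteq> {#}" using s(1) UNd by (auto simp: nodeg2_UNd)
        then have "size N > 0" by (simp add: nonempty_has_size)
        then have "sum_mset (image_mset lcount N) > 0" using size_le_sum_lcount[of N] by linarith
        then have "lcount x \<le> n" using L N by simp
        moreover have "nodeg2 x" using s(1) UNd that by (simp add: nodeg2_UNd)
        ultimately show ?thesis by simp
      qed
      then have "M \<in> {M. set_mset M \<subseteq> ?A \<and> size M \<le> Suc n}"
        using L size_le_sum_lcount[of M] by auto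
      then show ?thesis unfolding UNd by (rule imageI)
    qed (auto simp: UNd)
  qed
  then have "{s. nodeg2 s \<and> lcount s \<le> Suc n} \<subseteq> UNd ` {M. set_mset M \<subseteq> ?A \<and> size M \<le> Suc n}"
    by blast
  then show ?case by (rule finite_surj[OF finite_multisets_bounded[OF Suc]])
qed

lemma lcount_le_sum: "s \<in># M \<Longrightarrow> lcount s \<le> sum_mset (image_mset lcount M)"
  using multi_member_split[of s M] by auto

lemma finite_Tn_o: "finite (Tn_o n)"
proof -
  let ?A = "{s. nodeg2 s \<and> lcount s \<le> n}"
  have "Tn_o n \<subseteq> UNd ` {M. set_mset M \<subseteq> ?A \<and> size M \<le> n}"
  proof
    fix t assume t: "t \<in> Tn_o n"
    obtain M where M: "t = UNd M" by (cases t)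
    have "set_mset M \<subseteq> ?A \<and> size M \<le> n"
      using t M size_le_sum_lcount[of M] lcount_le_sum[of _ M] by (auto simp: Tn_o_def nleaves_def)
    then show "t \<in> UNd ` {M. set_mset M \<subseteq> ?A \<and> size M \<le> n}" using M by blast
  qed
  then show ?thesis by (rule finite_surj[OF finite_multisets_bounded[OF finite_nodeg2]])
qed

section \<open>Planar representatives\<close>

definition kids :: "otree \<Rightarrow> otree list" where "kids T = (case T of ONd ts \<Rightarrow> ts)"

lemma kids_ONd [simp]: "kids (ONd ts) = ts" by (simp add: kids_def)

lemma ONd_kids [simp]: "ONd (kids T) = T" by (cases T) simp

lemma shape_kids: "shape T = UNd (mset (map shape (kids T)))"
  by (cases T) simp

lemma nch_kids: "nch T p = length (kids (sub T p))"
  by (simp add: nch_def kids_def split: otree.split)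

lemma ex_shape: "\<exists>T. shape T = u"
proof (induction u)
  case (UNd M)
  then have "\<forall>s\<in>#M. \<exists>T. shape T = s" by blast
  then obtain f where f: "\<And>s. s \<in># M \<Longrightarrow> shape (f s) = s" by metis
  obtain us where us: "mset us = M" using ex_mset by blast
  have "map shape (map f us) = us" using f us by (auto simp: map_idI)
  then have "shape (ONd (map f us)) = UNd M" by (simp only: shape.simps us)
  then show ?case by blast
qed

lemma shape_rep: "shape (rep u) = u"
  unfolding rep_def using someI_ex[OF ex_shape] .

lemma ispos_append: "ispos T (p @ q) \<longleftrightarrow> ispos T p \<and> ispos (sub T p) q"
  by (induction T p rule: ispos.induct) auto

lemma sub_append: "ispos T p \<Longrightarrow> sub T (p @ q) = sub (sub T p) q"
  by (induction T p rule: ispos.induct) auto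

lemma ispos_Cons: "ispos T (i # p) \<longleftrightarrow> i < length (kids T) \<and> ispos (kids T ! i) p"
  by (cases T) simp

lemma sub_Cons: "sub T (i # p) = sub (kids T ! i) p"
  by (cases T) simp

lemma ispos_snoc: "ispos T (p @ [i]) \<longleftrightarrow> ispos T p \<and> i < length (kids (sub T p))"
  by (simp add: ispos_append ispos_Cons)

lemma sub_snoc: "ispos T p \<Longrightarrow> sub T (p @ [i]) = kids (sub T p) ! i"
  by (simp add: sub_append sub_Cons)

lemma ispos_take: "ispos T p \<Longrightarrow> ispos T (take k p)"
  by (metis append_take_drop_id ispos_append)

lemma sub_take_Suc: "ispos T p \<Longrightarrow> k < length p \<Longrightarrow>
    sub T (take (Suc k) p) = kids (sub T (take k p)) ! (p ! k)"
  by (simp add: take_Suc_conv_app_nth sub_snoc ispos_take)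

lemma nth_less_kids: "ispos T p \<Longrightarrow> k < length p \<Longrightarrow> p ! k < length (kids (sub T (take k p)))"
  by (metis ispos_snoc ispos_take take_Suc_conv_app_nth)

lemma finite_ispos: "finite {p. ispos T p}"
proof (induction T)
  case (ONd ts)
  have "{p. ispos (ONd ts) p} \<subseteq> insert [] (\<Union>i<length ts. (#) i ` {p. ispos (ts ! i) p})"
  proof
    fix p assume "p \<in> {p. ispos (ONd ts) p}"
    then show "p \<in> insert [] (\<Union>i<length ts. (#) i ` {p. ispos (ts ! i) p})"
      by (cases p) auto
  qed
  moreover have "finite (insert [] (\<Union>i<length ts. (#) i ` {p. ispos (ts ! i) p}))"
    using ONd by auto
  ultimately show ?case by (rule finite_subset)
qed

lemma isleaf_iff: "isleaf T p \<longleftrightarrow> ispos T p \<and> p \<noteq> [] \<and> kids (sub T p) = []"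
  by (simp add: isleaf_def nch_kids)

lemma ex_end: "\<exists>p. ispos T p \<and> kids (sub T p) = []"
proof (induction T)
  case (ONd ts)
  show ?case
  proof (cases ts)
    case Nil then show ?thesis by (intro exI[of _ "[]"]) simp
  next
    case (Cons t ts')
    then obtain p where "ispos t p" "kids (sub t p) = []" using ONd by auto
    then show ?thesis using Cons by (intro exI[of _ "0 # p"]) simp
  qed
qed

lemma isleaf_prefix: "isleaf T (take k p) \<Longrightarrow> ispos T p \<Longrightarrow> take k p = p"
  by (metis append_take_drop_id isleaf_iff ispos_append ispos_Cons list.size(3) neq_Nil_conv not_less_zero append_Nil2)

section \<open>Degree conditions on planar trees\<close>

fun degs :: "nat set \<Rightarrow> otree \<Rightarrow> bool" where
  "degs N (ONd ts) \<longleftrightarrow> length ts \<in> N \<and> (\<forall>s\<in>set ts. degs N s)"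

lemma degs_kids: "degs N T \<longleftrightarrow> length (kids T) \<in> N \<and> (\<forall>s\<in>set (kids T). degs N s)"
  by (cases T) simp

lemma nodeg2_shape: "nodeg2 (shape T) \<longleftrightarrow> degs (- {1}) T"
  by (induction T) (auto simp: nodeg2_UNd)

lemma binsub_shape: "binsub (shape T) \<longleftrightarrow> degs {0, 2} T"
  by (induction T) (auto simp: binsub_UNd)

text \<open>One predicate for both state spaces: \<open>rdegs UNIV (- {1})\<close> expresses the
  absence of vertices of degree two, \<open>rdegs {1} {0, 2}\<close> that the tree is binary. Their
  invariance under the chain then has a common proof.\<close>

definition rdegs :: "nat set \<Rightarrow> nat set \<Rightarrow> otree \<Rightarrow> bool" where
  "rdegs R N T \<longleftrightarrow> length (kids T) \<in> R \<and> (\<forall>s\<in>set (kids T). degs N s)"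

lemma Tn_o_shape: "shape T \<in> Tn_o n \<longleftrightarrow> nleaves (shape T) = n \<and> rdegs UNIV (- {1}) T"
  by (cases T) (auto simp: Tn_o_def rdegs_def nodeg2_shape)

lemma degs_mono: "degs N T \<Longrightarrow> N \<subseteq> N' \<Longrightarrow> degs N' T"
  by (induction T) auto

lemma Tn_bo_shape: "shape T \<in> Tn_bo n \<longleftrightarrow> nleaves (shape T) = n \<and> rdegs {1} {0, 2} T"
proof -
  have "rdegs UNIV (- {1}) T" if "rdegs {1} {0, 2} T"
    using that degs_mono[of "{0, 2}" _ "- {1}"] by (auto simp: rdegs_def)
  moreover have "shape T \<in> Tn_bo n \<longleftrightarrow> shape T \<in> Tn_o n \<and> rdegs {1} {0, 2} T"
    unfolding Tn_bo_def by (cases T) (auto simp: rdegs_def binsub_shape)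
  ultimately show ?thesis using Tn_o_shape by auto
qed

declare shape.simps [simp del]

lemma degs_sub: "degs N T \<Longrightarrow> ispos T p \<Longrightarrow> degs N (sub T p)"
  by (induction T p rule: ispos.induct) auto

lemma rdegs_sub: "rdegs R N T \<Longrightarrow> ispos T p \<Longrightarrow> p \<noteq> [] \<Longrightarrow> degs N (sub T p)"
  by (cases T; cases p) (auto simp: rdegs_def intro!: degs_sub)

text \<open>Counts a forest rather than a vertex: the empty list contributes nothing, whereas a
  childless vertex is itself a leaf. This makes the count additive when hanging lists are
  joined.\<close>

definition fleaves :: "otree list \<Rightarrow> nat" where
  "fleaves ts = (\<Sum>t\<leftarrow>ts. lcount (shape t))"

lemma fleaves_simps [simp]: "fleaves [] = 0" "fleaves (t # ts) = lcount (shape t) + fleaves ts"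
  "fleaves (ts @ us) = fleaves ts + fleaves us"
  by (simp_all add: fleaves_def)

lemma fleaves_mset: "fleaves ts = sum_mset (image_mset lcount (mset (map shape ts)))"
  by (simp add: fleaves_def sum_mset_sum_list[symmetric] multiset.map_comp comp_def)

lemma nleaves_shape: "nleaves (shape T) = fleaves (kids T)"
  by (simp add: nleaves_def fleaves_mset shape_kids)

lemma lcount_shape: "lcount (shape T) = (if kids T = [] then 1 else fleaves (kids T))"
  by (simp add: lcount_UNd fleaves_mset shape_kids[of T])

lemma fleaves_update: "i < length ts \<Longrightarrow>
    fleaves (ts[i := t]) + lcount (shape (ts ! i)) = fleaves ts + lcount (shape t)"
  by (induction ts arbitrary: i) (auto simp: nth_Cons split: nat.splits)

lemma kids_repl_Cons: "i < length (kids T) \<Longrightarrow>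
    repl T (i # p) S = ONd ((kids T)[i := repl (kids T ! i) p S])"
  by (cases T) simp

lemma graft_Cons: "i < length (kids T) \<Longrightarrow>
    graft T (i # p) = ONd ((kids T)[i := graft (kids T ! i) p])"
  by (simp add: graft_def kids_repl_Cons sub_Cons)

lemma lcount_graft: "ispos T p \<Longrightarrow> lcount (shape (graft T p)) = Suc (lcount (shape T))"
proof (induction p arbitrary: T)
  case Nil then show ?case by (simp add: graft_def lcount_shape[of "ONd _"])
next
  case (Cons i p)
  then have i: "i < length (kids T)" "ispos (kids T ! i) p" by (auto simp: ispos_Cons)
  then show ?case using Cons.IH[OF i(2)] fleaves_update[OF i(1), of "graft (kids T ! i) p"] i(1)
    by (auto simp: graft_Cons lcount_shape[of "ONd _"] lcount_shape[of T])
qed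

lemma nleaves_graft: "p \<in> edges T \<Longrightarrow> nleaves (shape (graft T p)) = Suc (nleaves (shape T))"
proof -
  assume p: "p \<in> edges T"
  then obtain i q where q: "p = i # q" "i < length (kids T)" "ispos (kids T ! i) q"
    by (cases p) (auto simp: edges_def ispos_Cons)
  then show ?thesis using lcount_graft[OF q(3)] fleaves_update[OF q(2), of "graft (kids T ! i) q"]
    by (simp add: nleaves_shape graft_Cons)
qed

lemma degs_graft:
  assumes "0 \<in> N" "2 \<in> N" "ispos T p" "degs N T" shows "degs N (graft T p)"
  using assms(3,4)
proof (induction p arbitrary: T)
  case Nil then show ?case using assms by (simp add: graft_def numeral_2_eq_2)
next
  case (Cons i p)
  then have i: "i < length (kids T)" "ispos (kids T ! i) p" by (auto simp: ispos_Cons)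
  then have "degs N (graft (kids T ! i) p)" using Cons by (auto simp: degs_kids[of N T])
  then show ?case using Cons.prems(2) i
    by (auto simp: graft_Cons degs_kids[of N T] dest!: set_update_subset_insert[THEN subsetD])
qed

lemma rdegs_graft:
  assumes "0 \<in> N" "2 \<in> N" "p \<in> edges T" "rdegs R N T" shows "rdegs R N (graft T p)"
proof -
  obtain i q where q: "p = i # q" "i < length (kids T)" "ispos (kids T ! i) q"
    using assms by (cases p) (auto simp: edges_def ispos_Cons)
  then have "degs N (graft (kids T ! i) q)" using assms degs_graft by (auto simp: rdegs_def)
  then show ?thesis using assms q
    by (auto simp: graft_Cons rdegs_def dest!: set_update_subset_insert[THEN subsetD])
qed

section \<open>The reduced tree spanned by two leaves\<close>

lemma lcp_take_left: "take (length (lcp a b)) a = lcp a b"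
  by (induction a b rule: lcp.induct) auto

lemma lcp_commute: "lcp a b = lcp b a"
  by (induction a b rule: lcp.induct) auto

lemma lcp_take_right: "take (length (lcp a b)) b = lcp a b"
  using lcp_take_left[of b a] by (simp add: lcp_commute)

lemma length_lcp_left: "length (lcp a b) \<le> length a"
  by (induction a b rule: lcp.induct) auto

lemma lcp_ge_iff: "k \<le> length (lcp a b) \<longleftrightarrow> k \<le> length a \<and> k \<le> length b \<and> take k a = take k b"
  by (induction a b arbitrary: k rule: lcp.induct) (auto simp: take_Cons split: nat.splits)

lemma length_lcp_ge:
  assumes "take k p = take k a" "k \<le> length p" shows "k \<le> length (lcp p a)"
proof -
  have "length (take k p) = length (take k a)" by (rule arg_cong[OF assms(1)])
  then have "k \<le> length a" using assms(2) by simp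
  then show ?thesis using assms by (simp add: lcp_ge_iff)
qed

lemma hang_alt: "hang T a b x = map ((!) (kids (sub T x)))
    (filter (\<lambda>i. \<not> inR2 a b (x @ [i])) [0..<length (kids (sub T x))])"
proof -
  have "map snd (filter (\<lambda>(i, s). P i) (zip [0..<length ts] ts)) = map ((!) ts) (filter P [0..<length ts])"
    for P and ts :: "otree list"
  proof -
    have "zip [0..<length ts] ts = map (\<lambda>i. (i, ts ! i)) [0..<length ts]"
      by (rule nth_equalityI) auto
    then show ?thesis by (simp add: filter_map comp_def)
  qed
  then show ?thesis by (simp add: hang_def kids_def split: otree.split)
qed

lemma inR2_commute: "inR2 a b = inR2 b a"
  by (auto simp: inR2_def fun_eq_iff)

lemma hang_commute: "hang T a b = hang T b a"
  by (simp add: hang_alt fun_eq_iff inR2_commute)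

text \<open>The path to b contributes a child only while it has not yet left the path to a; at depth
  \<open>length (lcp a b)\<close>, that is at Omega, the two children differ.\<close>

lemma inR2_take_snoc:
  assumes "k < length a"
  shows "inR2 a b (take k a @ [i]) \<longleftrightarrow>
    i = a ! k \<or> (k \<le> length (lcp a b) \<and> k < length b \<and> i = b ! k)"
proof -
  have "take (Suc k) a = take k a @ [i] \<longleftrightarrow> i = a ! k"
    using assms by (auto simp: take_Suc_conv_app_nth)
  moreover have "take (Suc k) b = take k a @ [i] \<longleftrightarrow>
      k \<le> length (lcp a b) \<and> k < length b \<and> i = b ! k"
  proof (cases "k < length b")
    case True
    then show ?thesis using assms by (auto simp: take_Suc_conv_app_nth lcp_ge_iff)
  next
    case False
    then have "length (take (Suc k) b) < Suc k" by simp
    then have "take (Suc k) b \<noteq> take k a @ [i]" using assms by auto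
    then show ?thesis using False by simp
  qed
  ultimately show ?thesis using assms by (simp add: inR2_def)
qed

lemma mset_split_filter:
  "mset ts = mset (map ((!) ts) (filter (\<lambda>i. \<not> P i) [0..<length ts]))
     + image_mset ((!) ts) (mset_set {i. i < length ts \<and> P i})"
proof -
  have 1: "mset_set {i. i < length ts \<and> P i} = filter_mset P (mset [0..<length ts])"
    by (simp add: filter_mset_mset_set conj_commute)
  have "mset ts = image_mset ((!) ts) (mset [0..<length ts])"
    by (metis map_nth mset_map)
  also have "mset [0..<length ts] =
      filter_mset (\<lambda>i. \<not> P i) (mset [0..<length ts]) + filter_mset P (mset [0..<length ts])"
    by (metis multiset_partition add.commute)
  finally show ?thesis unfolding 1 by (simp only: mset_map mset_filter image_mset_union)
qed

locale two_leaves =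
  fixes T :: otree and a b :: "nat list"
  assumes leaf_a: "isleaf T a" and leaf_b: "isleaf T b" and a_neq_b: "a \<noteq> b"
begin

text \<open>The depth of Omega. E_1 occupies the depths less than L, E_3 starts at depth L and E_2
  at depth \<open>Suc L\<close>.\<close>

definition L :: nat where "L = length (lcp a b)"

lemma two_leaves_commute: "two_leaves T b a"
  using leaf_a leaf_b a_neq_b by unfold_locales auto

lemma pos_a: "ispos T a" and pos_b: "ispos T b" using leaf_a leaf_b by (auto simp: isleaf_iff)

text \<open>If a ended at Omega, it would be a prefix of b, but nothing lies below a leaf.\<close>

lemma L_less_a: "L < length a"
proof (rule ccontr)
  assume "\<not> L < length a"
  then have "L = length a" using length_lcp_left[of a b] by (simp add: L_def)
  then have "take L b = a" using lcp_take_left[of a b] lcp_take_right[of a b] by (simp add: L_def)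
  then show False using isleaf_prefix[of T L b] leaf_a pos_b a_neq_b by simp
qed

lemma L_less_b: "L < length b"
proof (rule ccontr)
  assume "\<not> L < length b"
  then have "L = length b" using length_lcp_left[of b a] by (simp add: L_def lcp_commute)
  then have "take L a = b" using lcp_take_left[of a b] lcp_take_right[of a b] by (simp add: L_def)
  then show False using isleaf_prefix[of T L a] leaf_b pos_a a_neq_b by simp
qed

lemma take_L: "take L a = take L b"
  by (simp add: L_def lcp_take_left lcp_take_right)

lemma lcp_L: "lcp a b = take L a"
  by (simp add: L_def lcp_take_left)

lemma take_eq_iff: "k \<le> length a \<Longrightarrow> k \<le> length b \<Longrightarrow> take k a = take k b \<longleftrightarrow> k \<le> L"
  by (simp add: L_def lcp_ge_iff)

lemma nth_less_L: "k < L \<Longrightarrow> a ! k = b ! k"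
  by (metis nth_take take_L)

lemma nth_L: "a ! L \<noteq> b ! L"
  using take_eq_iff[of "Suc L"] L_less_a L_less_b take_L by (auto simp: take_Suc_conv_app_nth)

lemma mset_hang_a:
  assumes "k < length a" "k \<noteq> L"
  shows "mset (kids (sub T (take k a))) =
    add_mset (sub T (take (Suc k) a)) (mset (hang T a b (take k a)))"
proof -
  let ?ts = "kids (sub T (take k a))"
  have "inR2 a b (take k a @ [i]) \<longleftrightarrow> i = a ! k" for i
    using assms nth_less_L[of k] L_def inR2_take_snoc[of k a b i] by auto
  moreover have "{i. i < length ?ts \<and> i = a ! k} = {a ! k}"
    using nth_less_kids[OF pos_a assms(1)] by auto
  ultimately show ?thesis
    using mset_split_filter[of ?ts "\<lambda>i. inR2 a b (take k a @ [i])"] sub_take_Suc[OF pos_a assms(1)]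
    by (simp add: hang_alt)
qed

lemma mset_hang_L:
  "mset (kids (sub T (take L a))) =
    {#sub T (take (Suc L) a), sub T (take (Suc L) b)#} + mset (hang T a b (take L a))"
proof -
  let ?ts = "kids (sub T (take L a))"
  have "inR2 a b (take L a @ [i]) \<longleftrightarrow> i = a ! L \<or> i = b ! L" for i
    using L_less_a L_less_b L_def inR2_take_snoc[of L a b i] by auto
  moreover have "{i. i < length ?ts \<and> (i = a ! L \<or> i = b ! L)} = {a ! L, b ! L}"
    using nth_less_kids[OF pos_a L_less_a] nth_less_kids[OF pos_b L_less_b] take_L by auto
  ultimately show ?thesis
    using mset_split_filter[of ?ts "\<lambda>i. inR2 a b (take L a @ [i])"] nth_L
      sub_take_Suc[OF pos_a L_less_a] sub_take_Suc[OF pos_b L_less_b] take_L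
    by (simp add: hang_alt)
qed

text \<open>Descending from a hanging child to any end of its subtree gives an unselected leaf. So a
  vertex of positive mass is hit by some label.\<close>

lemma ex_leaf_projecting:
  assumes "k < length a" "hang T a b (take k a) \<noteq> []"
  shows "\<exists>p. isleaf T p \<and> p \<noteq> a \<and> p \<noteq> b \<and> projR2 a b p = take k a"
proof -
  let ?x = "take k a"
  obtain i where i: "i < length (kids (sub T ?x))" "\<not> inR2 a b (?x @ [i])"
    using assms(2) by (auto simp: hang_alt filter_empty_conv)
  obtain q where q: "ispos (sub T (?x @ [i])) q" "kids (sub (sub T (?x @ [i])) q) = []"
    using ex_end by blast
  define p where "p = (?x @ [i]) @ q"
  have pos: "ispos T (?x @ [i])" using i ispos_take[OF pos_a] by (simp add: ispos_snoc)
  have leaf: "isleaf T p"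
    unfolding p_def isleaf_iff using pos q by (simp add: ispos_append[of _ "?x @ [i]"] sub_append[of _ "?x @ [i]"] del: append_assoc)
  have tp: "take (Suc k) p = ?x @ [i]" using assms(1) by (simp add: p_def)
  have na: "take (Suc k) p \<noteq> take (Suc k) a" and nb: "take (Suc k) p \<noteq> take (Suc k) b"
    using i(2) assms(1) unfolding tp inR2_def by auto
  have "take k p = ?x" using assms(1) by (simp add: p_def)
  moreover have lp: "k < length p" using assms(1) by (simp add: p_def)
  ultimately have "k \<le> length (lcp p a)" using assms(1) by (simp add: lcp_ge_iff)
  moreover have "\<not> Suc k \<le> length (lcp p a)" "\<not> Suc k \<le> length (lcp p b)"
    using na nb by (auto simp: lcp_ge_iff)
  ultimately have "length (lcp p a) = k" "length (lcp p b) \<le> k" by auto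
  then have "projR2 a b p = ?x" using lcp_take_right[of p a] by (simp add: projR2_def)
  moreover have "p \<noteq> a" "p \<noteq> b" using na nb by auto
  ultimately show ?thesis using leaf by blast
qed

lemma projR2_commute: "projR2 a b p = projR2 b a p"
  using lcp_take_left[of p a] lcp_take_left[of p b] by (auto simp: projR2_def)

text \<open>Converse of \<open>ex_leaf_projecting\<close>: the path to p leaves the reduced tree at
  the projection, and its next vertex is the root of a hanging subtree.\<close>

lemma hang_projR2_nonempty:
  assumes "isleaf T p" "p \<noteq> a" "p \<noteq> b"
  shows "hang T a b (projR2 a b p) \<noteq> []"
proof -
  let ?x = "projR2 a b p" and ?k = "length (projR2 a b p)"
  have pa: "length (lcp p a) \<le> ?k" and pb: "length (lcp p b) \<le> ?k" by (auto simp: projR2_def)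
  have tk: "take ?k p = ?x" by (simp add: projR2_def lcp_take_left)
  \<comment> \<open>Distinct leaves branch strictly above both of them, so the path to p continues
    beyond the projection.\<close>
  interpret pa: two_leaves T p a using assms leaf_a by unfold_locales auto
  interpret pb: two_leaves T p b using assms leaf_b by unfold_locales auto
  have kp: "?k < length p" using pa.L_less_a pb.L_less_a by (simp add: projR2_def pa.L_def pb.L_def)
  have xp: "take (Suc ?k) p = ?x @ [p ! ?k]" using take_Suc_conv_app_nth[OF kp] tk by simp
  have "\<not> Suc ?k \<le> length (lcp p a)" "\<not> Suc ?k \<le> length (lcp p b)" using pa pb by auto
  then have "take (Suc ?k) a \<noteq> ?x @ [p ! ?k]" "take (Suc ?k) b \<noteq> ?x @ [p ! ?k]"
    using kp xp length_lcp_ge[of "Suc ?k" p] by auto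
  then have "\<not> inR2 a b (?x @ [p ! ?k])" by (simp add: inR2_def)
  moreover have "p ! ?k < length (kids (sub T ?x))" using nth_less_kids[OF pa.pos_a kp] tk by simp
  ultimately show ?thesis by (auto simp: hang_alt filter_empty_conv)
qed

end

section \<open>The cutting procedure\<close>

text \<open>Vertices are recorded as pairs of branch and depth, so that cutting removes an interval
  of depths. That different pairs give different vertices is the separate fact
  \<open>inj_vertex\<close>.\<close>

definition remaining :: "(nat list \<times> nat) list \<Rightarrow> nat list \<Rightarrow> (nat \<times> nat) set" where
  "remaining Bs c = (SIGMA i:{..<length Bs}. {c ! i..<snd (Bs ! i)})"

definition vertex :: "(nat list \<times> nat) list \<Rightarrow> nat \<times> nat \<Rightarrow> nat list" where
  "vertex Bs = (\<lambda>(i, k). take k (fst (Bs ! i)))"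

lemma find_upt_None: "find P [0..<n] = None \<longleftrightarrow> (\<forall>i<n. \<not> P i)"
  by (auto simp: find_None_iff)

lemma find_upt_Some: "find P [0..<n] = Some i \<Longrightarrow> i < n \<and> P i"
  by (auto simp: find_Some_iff)

lemma vertex_inbr:
  assumes "z \<in> remaining Bs c" "\<forall>i<length Bs. snd (Bs ! i) \<le> length (fst (Bs ! i))"
  shows "fst z < length Bs \<and> inbr (Bs ! fst z) (c ! fst z) (vertex Bs z) \<and> snd z = length (vertex Bs z)"
  using assms by (force simp: remaining_def vertex_def inbr_def)

lemma remaining_update:
  assumes "length c = length Bs" "i < length Bs" "c ! i \<le> k" "k < snd (Bs ! i)"
  shows "remaining Bs c = remaining Bs (c[i := Suc k]) \<union> Pair i ` {c ! i..<Suc k}"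
    "remaining Bs (c[i := Suc k]) \<inter> Pair i ` {c ! i..<Suc k} = {}"
  using assms by (auto simp: remaining_def nth_list_update split: if_splits)

lemma finite_remaining: "finite (remaining Bs c)"
  by (simp add: remaining_def)

text \<open>Whatever the label order, the blocks visit each vertex carrying weight exactly once.\<close>

lemma sum_cutblocks:
  fixes f :: "nat list \<Rightarrow> nat"
  assumes len: "\<forall>i<length Bs. snd (Bs ! i) \<le> length (fst (Bs ! i))"
    and "length c = length Bs" "inj_on (vertex Bs) (remaining Bs c)"
    and "\<forall>z\<in>remaining Bs c. f (vertex Bs z) \<noteq> 0 \<longrightarrow> vertex Bs z \<in> set ys"
  shows "(\<Sum>v\<leftarrow>concat (cutblocks Bs c ys). f v) = (\<Sum>z\<in>remaining Bs c. f (vertex Bs z))"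
  using assms(2-)
proof (induction ys arbitrary: c)
  case Nil
  then show ?case by simp
next
  case (Cons y ys)
  show ?case
  proof (cases "find (\<lambda>i. inbr (Bs ! i) (c ! i) y) [0..<length Bs]")
    \<comment> \<open>A point outside the remaining parts is none of the weighted vertices still to
      be visited, so discarding it preserves the hypothesis on the label points.\<close>
    case None
    then have "\<forall>i<length Bs. \<not> inbr (Bs ! i) (c ! i) y" by (simp add: find_upt_None)
    then have "vertex Bs z \<noteq> y" if "z \<in> remaining Bs c" for z
      using vertex_inbr[OF that len] by blast
    then show ?thesis using None Cons by auto
  next
    case (Some i)
    define k where "k = length y"
    have i: "i < length Bs" "inbr (Bs ! i) (c ! i) y" using find_upt_Some[OF Some] by auto
    then have k: "c ! i \<le> k" "k < snd (Bs ! i)" "y = vertex Bs (i, k)"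
      by (auto simp: inbr_def k_def vertex_def)
    let ?c = "c[i := Suc k]"
    note split = remaining_update[OF Cons.prems(1) i(1) k(1,2)]
    have ik: "(i, k) \<in> remaining Bs c" "(i, k) \<notin> remaining Bs ?c"
      using split k by auto
    \<comment> \<open>By injectivity no vertex left after the cut has the address y, so those
      carrying weight must occur later, in \<open>ys\<close>.\<close>
    have ne: "vertex Bs z \<noteq> y" if "z \<in> remaining Bs ?c" for z
      using that ik split(1) Cons.prems(2) k(3) by (metis UnI1 inj_onD)
    have IH: "(\<Sum>v\<leftarrow>concat (cutblocks Bs ?c ys). f v) = (\<Sum>z\<in>remaining Bs ?c. f (vertex Bs z))"
    proof (rule Cons.IH)
      show "length ?c = length Bs" using Cons.prems by simp
      show "inj_on (vertex Bs) (remaining Bs ?c)"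
        using Cons.prems(2) split(1) by (metis Un_upper1 inj_on_subset)
      show "\<forall>z\<in>remaining Bs ?c. f (vertex Bs z) \<noteq> 0 \<longrightarrow> vertex Bs z \<in> set ys"
        using Cons.prems(3) split(1) ne by auto
    qed
    have "(\<Sum>v\<leftarrow>map (\<lambda>j. take j (fst (Bs ! i))) [c ! i..<Suc k]. f v)
        = (\<Sum>j\<in>{c ! i..<Suc k}. f (vertex Bs (i, j)))"
      by (simp only: interv_sum_list_conv_sum_set_nat set_upt map_map comp_def vertex_def prod.case)
    also have "\<dots> = (\<Sum>z\<in>Pair i ` {c ! i..<Suc k}. f (vertex Bs z))"
      by (simp add: sum.reindex inj_on_def)
    finally have "(\<Sum>v\<leftarrow>map (\<lambda>j. take j (fst (Bs ! i))) [c ! i..<Suc k]. f v)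
        = (\<Sum>z\<in>Pair i ` {c ! i..<Suc k}. f (vertex Bs z))" .
    then have "(\<Sum>v\<leftarrow>concat (cutblocks Bs c (y # ys)). f v)
        = (\<Sum>z\<in>Pair i ` {c ! i..<Suc k}. f (vertex Bs z)) + (\<Sum>z\<in>remaining Bs ?c. f (vertex Bs z))"
      using IH Some by (simp add: k_def[symmetric] del: upt_Suc)
    also have "\<dots> = (\<Sum>z\<in>remaining Bs c. f (vertex Bs z))"
      unfolding split(1) using split(2) finite_remaining[of Bs ?c]
      by (subst sum.union_disjoint) auto
    finally show ?thesis .
  qed
qed

text \<open>Serves to locate start points: cuts only move forward, so a block can contain the start
  of its branch at most as its first vertex.\<close>

lemma cutblocks_shape:
  assumes "bl \<in> set (cutblocks Bs c ys)" "length c = length Bs"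
  shows "\<exists>i l h. i < length Bs \<and> c ! i \<le> l \<and> l \<le> h \<and> h < snd (Bs ! i) \<and>
    bl = map (\<lambda>k. take k (fst (Bs ! i))) [l..<Suc h]"
  using assms
proof (induction ys arbitrary: c)
  case (Cons y ys)
  show ?case
  proof (cases "find (\<lambda>i. inbr (Bs ! i) (c ! i) y) [0..<length Bs]")
    case None
    then show ?thesis using Cons by simp
  next
    case (Some i)
    have i: "i < length Bs" "inbr (Bs ! i) (c ! i) y" using find_upt_Some[OF Some] by auto
    show ?thesis
    proof (cases "bl \<in> set (cutblocks Bs (c[i := Suc (length y)]) ys)")
      case True
      then obtain j l h where j: "j < length Bs" "c[i := Suc (length y)] ! j \<le> l" "l \<le> h"
        "h < snd (Bs ! j)" "bl = map (\<lambda>k. take k (fst (Bs ! j))) [l..<Suc h]"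
        using Cons.IH[OF True] Cons.prems(2) by auto
      moreover have "c ! j \<le> c[i := Suc (length y)] ! j"
        using i j(1) Cons.prems(2) by (auto simp: nth_list_update inbr_def)
      ultimately show ?thesis
        by (intro exI[of _ j] exI[of _ l] exI[of _ h]) (simp del: upt_Suc)
    next
      case False
      then have "bl = map (\<lambda>k. take k (fst (Bs ! i))) [c ! i..<Suc (length y)]"
        using Cons.prems(1) Some by (simp del: upt_Suc)
      then show ?thesis using i by (auto simp: inbr_def)
    qed
  qed
qed simp

section \<open>Gluing blocks to a spine\<close>

lemma glue_nonempty: "sp \<noteq> [] \<Longrightarrow> glue h St sp bls \<noteq> []"
  by (induction bls arbitrary: sp) (auto split: list.split)

lemma fleaves_glue:
  "sp \<noteq> [] \<Longrightarrow> (\<Sum>hs\<leftarrow>glue h St sp bls. fleaves hs) =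
     (\<Sum>hs\<leftarrow>sp. fleaves hs) + (\<Sum>v\<leftarrow>concat bls. fleaves (h v))"
proof (induction bls arbitrary: sp)
  case (Cons bl bls)
  have sp: "(\<Sum>hs\<leftarrow>butlast sp. fleaves hs) + fleaves (last sp) = (\<Sum>hs\<leftarrow>sp. fleaves hs)"
    using Cons.prems by (cases sp rule: rev_cases) simp_all
  show ?case using Cons.prems sp
    by (cases bl) (simp_all add: Cons.IH comp_def)
qed simp

text \<open>Z, W and R collect the admissible numbers of subtrees hanging at a start point, at a
  spine vertex other than the root, and at the root. Joining a start point adds an element of Z to
  the last spine vertex, which is the root as long as the spine has one entry; hence the two closure
  conditions.\<close>

lemma glue_invariant:
  assumes "\<forall>bl\<in>set bls. \<exists>v vs. bl = v # vs \<and> (v \<in> St \<longrightarrow> length (h v) \<in> Z) \<and>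
      (v \<notin> St \<longrightarrow> length (h v) \<in> W) \<and> (\<forall>x\<in>set vs. length (h x) \<in> W)"
    and "\<And>w z. w \<in> W \<Longrightarrow> z \<in> Z \<Longrightarrow> w + z \<in> W" and "\<And>r z. r \<in> R \<Longrightarrow> z \<in> Z \<Longrightarrow> r + z \<in> R"
    and "sp \<noteq> []" "length (hd sp) \<in> R" "\<forall>hs\<in>set (tl sp). length hs \<in> W"
  shows "glue h St sp bls \<noteq> [] \<and> length (hd (glue h St sp bls)) \<in> R \<and>
    (\<forall>hs\<in>set (tl (glue h St sp bls)). length hs \<in> W)"
  using assms(1,4-)
proof (induction bls arbitrary: sp)
  case (Cons bl bls)
  from Cons.prems(1) obtain v vs where bl: "bl = v # vs" "v \<in> St \<Longrightarrow> length (h v) \<in> Z"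
    "v \<notin> St \<Longrightarrow> length (h v) \<in> W" "\<forall>x\<in>set vs. length (h x) \<in> W" by auto
  obtain r sp' where sp: "sp = r # sp'" using Cons.prems(2) by (cases sp) auto
  let ?sp = "if v \<in> St then butlast sp @ [last sp @ h v] @ map h vs else sp @ map h (v # vs)"
  have "?sp \<noteq> []" using sp by simp
  moreover have "length (hd ?sp) \<in> R"
    using Cons.prems(3) bl(2) assms(3) by (cases sp' rule: rev_cases) (auto simp: sp)
  moreover have "\<forall>hs\<in>set (tl ?sp). length hs \<in> W"
  proof (cases sp' rule: rev_cases)
    case Nil then show ?thesis using bl by (auto simp: sp)
  next
    case (snoc ss s)
    then show ?thesis using bl Cons.prems(4) assms(2) by (auto simp: sp)
  qed
  ultimately have "glue h St ?sp bls \<noteq> [] \<and> length (hd (glue h St ?sp bls)) \<in> R \<and>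
    (\<forall>hs\<in>set (tl (glue h St ?sp bls)). length hs \<in> W)"
    using Cons.prems(1) by (intro Cons.IH) auto
  moreover have eq: "glue h St sp (bl # bls) = glue h St ?sp bls" by (simp add: bl(1))
  ultimately show ?case unfolding eq by blast
qed simp

lemma glue_elems:
  "\<forall>v\<in>set (concat bls). \<forall>s\<in>set (h v). P s \<Longrightarrow> \<forall>hs\<in>set sp. \<forall>s\<in>set hs. P s \<Longrightarrow> sp \<noteq> [] \<Longrightarrow>
   hs \<in> set (glue h St sp bls) \<Longrightarrow> s \<in> set hs \<Longrightarrow> P s"
proof (induction bls arbitrary: sp)
  case (Cons bl bls)
  let ?sp = "case bl of [] \<Rightarrow> sp
                 | v # vs \<Rightarrow> if v \<in> St then butlast sp @ [last sp @ h v] @ map h vs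
                              else sp @ map h (v # vs)"
  show ?case
  proof (rule Cons.IH)
    show "\<forall>v\<in>set (concat bls). \<forall>s\<in>set (h v). P s" using Cons.prems(1) by auto
    show "\<forall>hs\<in>set ?sp. \<forall>s\<in>set hs. P s"
      using Cons.prems(1-3) last_in_set[of sp] by (auto split: list.split dest: in_set_butlastD)
    show "?sp \<noteq> []" using Cons.prems(3) by (auto split: list.split)
    show "hs \<in> set (glue h St ?sp bls)" using Cons.prems(4) by simp
  qed (rule Cons.prems(5))
qed auto

lemma lcount_build: "lcount (shape (build hss)) = (\<Sum>hs\<leftarrow>hss. fleaves hs) + 1"
  by (induction hss) (auto simp: lcount_shape[of "ONd _"])

lemma nleaves_build: "hss \<noteq> [] \<Longrightarrow> nleaves (shape (build hss)) = (\<Sum>hs\<leftarrow>hss. fleaves hs) + 1"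
  by (cases hss) (auto simp: nleaves_shape lcount_build)

lemma degs_build:
  assumes "0 \<in> N" "\<forall>hs\<in>set hss. Suc (length hs) \<in> N \<and> (\<forall>s\<in>set hs. degs N s)"
  shows "degs N (build hss)"
  using assms(2) by (induction hss) (auto simp: assms(1))

lemma rdegs_build:
  assumes "hss \<noteq> []" "Suc (length (hd hss)) \<in> R" "0 \<in> N" "\<forall>hs\<in>set (tl hss). Suc (length hs) \<in> N"
    "\<forall>hs\<in>set hss. \<forall>s\<in>set hs. degs N s"
  shows "rdegs R N (build hss)"
  using assms degs_build[of N "tl hss"] by (cases hss) (auto simp: rdegs_def)

section \<open>Leaf number and degrees after the cutting procedure\<close>

context two_leaves begin

text \<open>The branches of \<open>newtree\<close> in terms of L. The cuts in
  \<open>start_cuts\<close> begin at L for E_3 and at \<open>Suc L\<close> for E_2 because Omega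
  belongs to E_3.\<close>

definition branches :: "(nat list \<times> nat) list" where
  "branches = [(take L a, L), (a, length a), (b, length b)]"

definition start_cuts :: "nat list" where "start_cuts = [0, Suc L, L]"

lemma newtree_alt: "newtree T a b \<sigma> =
  build (glue (hang T a b) {[], take L a} [[]] (cutblocks branches start_cuts (map (projR2 a b) \<sigma>)))"
  by (simp add: newtree_def Let_def lcp_L branches_def start_cuts_def L_less_a less_imp_le)

lemma less_3_cases: "i < length branches \<Longrightarrow> i = 0 \<or> i = 1 \<or> i = 2"
  by (auto simp: branches_def)

lemma branches_len: "\<forall>i<length branches. snd (branches ! i) \<le> length (fst (branches ! i))"
  using L_less_a by (auto simp: branches_def less_Suc_eq nth_Cons')

lemma vertex_simps [simp]: "vertex branches (0, k) = take (min k L) a"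
   "vertex branches (Suc 0, k) = take k a" "vertex branches (2, k) = take k b"
  by (simp_all add: vertex_def branches_def)

lemma remaining_start: "remaining branches start_cuts =
    Pair 0 ` {0..<L} \<union> Pair (Suc 0) ` {Suc L..<length a} \<union> Pair 2 ` {L..<length b}"
  by (auto simp: remaining_def branches_def start_cuts_def less_Suc_eq nth_Cons' split: if_splits)

text \<open>Equal addresses have equal depth, and the two paths agree only up to depth L; counting
  Omega in E_3 alone prevents a repetition there.\<close>

lemma inj_vertex: "inj_on (vertex branches) (remaining branches start_cuts)"
proof -
  show ?thesis
  proof (rule inj_onI)
    fix x y
    assume x: "x \<in> remaining branches start_cuts" and y: "y \<in> remaining branches start_cuts"
      and eq: "vertex branches x = vertex branches y"
    have "snd x = snd y"
      using vertex_inbr[OF x branches_len] vertex_inbr[OF y branches_len] eq by simp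
    then show "x = y"
      using x y eq take_eq_iff[of "snd x"] unfolding remaining_start by auto
  qed
qed

lemma sum_remaining_start:
  fixes f :: "nat list \<Rightarrow> nat"
  shows "(\<Sum>z\<in>remaining branches start_cuts. f (vertex branches z)) =
   (\<Sum>k\<in>{0..<L}. f (take k a)) + (\<Sum>k\<in>{Suc L..<length a}. f (take k a)) + (\<Sum>k\<in>{L..<length b}. f (take k b))"
proof -
  have "(\<Sum>z\<in>remaining branches start_cuts. f (vertex branches z)) =
    (\<Sum>z\<in>Pair 0 ` {0..<L}. f (vertex branches z)) + (\<Sum>z\<in>Pair (Suc 0) ` {Suc L..<length a}. f (vertex branches z))
    + (\<Sum>z\<in>Pair 2 ` {L..<length b}. f (vertex branches z))"
    unfolding remaining_start
    by (subst sum.union_disjoint, simp, simp, force, subst sum.union_disjoint) auto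
  moreover have "(\<Sum>z\<in>Pair i ` A. g z) = (\<Sum>k\<in>A. g (i, k))" for i :: nat and A and g :: "nat \<times> nat \<Rightarrow> nat"
    by (subst sum.reindex) (auto simp: inj_on_def)
  moreover have "(\<Sum>k\<in>{0..<L}. f (take (min k L) a)) = (\<Sum>k\<in>{0..<L}. f (take k a))"
    by (intro sum.cong) (auto simp: min_def)
  ultimately show ?thesis by simp
qed

abbreviation H where "H \<equiv> hang T a b"

lemma lcount_path_a:
  assumes "L < m" "m \<le> length a"
  shows "(\<Sum>k\<in>{m..<length a}. fleaves (H (take k a))) + 1 = lcount (shape (sub T (take m a)))"
  using assms(2,1)
proof (induction m rule: inc_induct)
  case base
  then show ?case using leaf_a by (simp add: isleaf_iff lcount_shape)
next
  case (step m)
  have m: "mset (kids (sub T (take m a))) = add_mset (sub T (take (Suc m) a)) (mset (H (take m a)))"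
    using mset_hang_a step by simp
  then have "kids (sub T (take m a)) \<noteq> []" by auto
  moreover have "fleaves (kids (sub T (take m a))) =
      lcount (shape (sub T (take (Suc m) a))) + fleaves (H (take m a))"
    by (simp add: fleaves_mset m)
  ultimately show ?case using step by (simp add: lcount_shape[of "sub T (take m a)"] sum.atLeast_Suc_lessThan)
qed

end

text \<open>Leaves are counted down to Omega and then along both paths; the summand 2 stands for a
  and b.\<close>

lemma (in two_leaves) total_leaves:
  "nleaves (shape T) = (\<Sum>k\<in>{0..<L}. fleaves (H (take k a))) +
     (\<Sum>k\<in>{Suc L..<length a}. fleaves (H (take k a))) + (\<Sum>k\<in>{L..<length b}. fleaves (H (take k b))) + 2"
proof -
  interpret ba: two_leaves T b a by (rule two_leaves_commute)
  have Lba: "ba.L = L" by (simp add: ba.L_def L_def lcp_commute)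
  let ?g = "\<lambda>k. fleaves (kids (sub T (take k a)))"
  have "?g m = (\<Sum>k\<in>{m..<L}. fleaves (H (take k a))) + ?g L" if "m \<le> L" for m
    using that
  proof (induction m rule: inc_induct)
    case (step m)
    have m: "mset (kids (sub T (take m a))) = add_mset (sub T (take (Suc m) a)) (mset (H (take m a)))"
      using mset_hang_a step L_less_a by simp
    have "kids (sub T (take (Suc m) a)) \<noteq> []"
      using nth_less_kids[OF pos_a, of "Suc m"] step L_less_a by auto
    then have "?g m = ?g (Suc m) + fleaves (H (take m a))"
      by (simp add: fleaves_mset[of "kids (sub T (take m a))"] m lcount_shape)
         (simp add: fleaves_mset)
    then show ?case using step by (simp add: sum.atLeast_Suc_lessThan)
  qed simp
  from this[of 0] have "nleaves (shape T) = (\<Sum>k\<in>{0..<L}. fleaves (H (take k a))) + ?g L"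
    by (simp add: nleaves_shape)
  also have "?g L = fleaves (H (take L a)) + lcount (shape (sub T (take (Suc L) a)))
      + lcount (shape (sub T (take (Suc L) b)))"
    by (simp add: fleaves_mset mset_hang_L)
  also have "lcount (shape (sub T (take (Suc L) a))) = (\<Sum>k\<in>{Suc L..<length a}. fleaves (H (take k a))) + 1"
    using lcount_path_a[of "Suc L"] L_less_a by simp
  also have "lcount (shape (sub T (take (Suc L) b))) = (\<Sum>k\<in>{Suc L..<length b}. fleaves (H (take k b))) + 1"
    using ba.lcount_path_a[of "Suc L"] L_less_b Lba by (simp add: hang_commute[of T b a])
  finally show ?thesis using L_less_b take_L by (simp add: sum.atLeast_Suc_lessThan)
qed

context two_leaves begin

lemma hang_sub: "s \<in> set (H x) \<Longrightarrow> \<exists>i<length (kids (sub T x)). s = kids (sub T x) ! i"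
  by (auto simp: hang_alt)

lemma degs_hang:
  assumes "rdegs R N T" "ispos T x" "s \<in> set (H x)" shows "degs N s"
proof (cases "x = []")
  case True
  then show ?thesis using hang_sub[OF assms(3)] assms(1) by (auto simp: rdegs_def)
next
  case False
  then have "degs N (sub T x)" using assms rdegs_sub by blast
  then show ?thesis using hang_sub[OF assms(3)] by (auto simp: degs_kids[of N "sub T x"])
qed

lemma length_kids_a: "k < length a \<Longrightarrow> k \<noteq> L \<Longrightarrow> length (kids (sub T (take k a))) = Suc (length (H (take k a)))"
  using arg_cong[OF mset_hang_a, of k size] by simp

lemma length_kids_L: "length (kids (sub T (take L a))) = Suc (Suc (length (H (take L a))))"
  using arg_cong[OF mset_hang_L, of size] by simp

end

text \<open>The root and Omega can occur only as the first vertex of a branch, so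
  \<open>glue\<close> has to join at most the first vertex of each block.\<close>

lemma (in two_leaves) cutblocks_branches:
  assumes "bl \<in> set (cutblocks branches start_cuts ys)"
  shows "\<exists>v vs. bl = v # vs \<and> (\<forall>x\<in>set bl. (\<exists>k<length a. x = take k a) \<or> (\<exists>k<length b. x = take k b)) \<and>
    (\<forall>x\<in>set vs. x \<notin> {[], take L a})"
proof -
  obtain i l h where i: "i < length branches" "start_cuts ! i \<le> l" "l \<le> h" "h < snd (branches ! i)"
     "bl = map (\<lambda>k. take k (fst (branches ! i))) [l..<Suc h]"
    using cutblocks_shape[OF assms] by (auto simp: branches_def start_cuts_def)
  define P where "P = fst (branches ! i)"
  define onpath where "onpath x \<longleftrightarrow> (\<exists>k<length a. x = take k a) \<or> (\<exists>k<length b. x = take k b)" for x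
  have P: "h < length P \<and> (\<forall>k. l < k \<and> k \<le> h \<longrightarrow> k \<noteq> L) \<and> (\<forall>k\<le>h. onpath (take k P))"
    using less_3_cases[OF i(1)]
  proof (elim disjE)
    assume 0: "i = 0"
    have "h < L" "P = take L a" using i 0 by (simp_all add: branches_def P_def)
    moreover have "onpath (take k (take L a))" if "k < L" for k
      unfolding onpath_def using that L_less_a by (intro disjI1 exI[of _ k]) simp
    ultimately show ?thesis using L_less_a by auto
  next
    assume 1: "i = 1"
    have "h < length a" "Suc L \<le> l" "P = a" using i 1 by (simp_all add: branches_def start_cuts_def P_def)
    then show ?thesis unfolding onpath_def by (auto intro: le_less_trans)
  next
    assume 2: "i = 2"
    have "h < length b" "L \<le> l" "P = b" using i 2 by (simp_all add: branches_def start_cuts_def P_def)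
    then show ?thesis unfolding onpath_def by (auto intro: le_less_trans)
  qed
  have bl: "bl = take l P # map (\<lambda>k. take k P) [Suc l..<Suc h]"
    using i(3,5) upt_conv_Cons[of l "Suc h"] by (simp add: P_def del: upt_Suc)
  have "onpath x" if "x \<in> set bl" for x
  proof -
    from that obtain k where "k \<le> h" "x = take k P"
      unfolding i(5) P_def[symmetric] by (auto simp: less_Suc_eq_le simp del: upt_Suc)
    then show ?thesis using P by blast
  qed
  moreover have "x \<notin> {[], take L a}" if "x \<in> set (map (\<lambda>k. take k P) [Suc l..<Suc h])" for x
  proof -
    from that obtain k where k: "l < k" "k \<le> h" "x = take k P"
      by (auto simp: less_Suc_eq_le Suc_le_eq simp del: upt_Suc)
    then have "length x = k" "k \<noteq> L" using P by auto
    then show ?thesis using k(1) L_less_a by auto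
  qed
  ultimately show ?thesis using bl unfolding onpath_def by blast
qed

text \<open>By \<open>sum_cutblocks\<close> the hanging leaves all survive, for any label order. Of
  a and b only the final leaf of the spine is left, so the loss undoes the leaf added by
  \<open>graft\<close>.\<close>

lemma (in two_leaves) nleaves_newtree:
  assumes "set \<sigma> = {p. isleaf T p} - {a, b}"
  shows "Suc (nleaves (shape (newtree T a b \<sigma>))) = nleaves (shape T)"
proof -
  interpret ba: two_leaves T b a by (rule two_leaves_commute)
  let ?ys = "map (projR2 a b) \<sigma>" and ?f = "\<lambda>v. fleaves (H v)"
  have hit: "x \<in> set ?ys" if nz: "H x \<noteq> []" and "(\<exists>k<length a. x = take k a) \<or> (\<exists>k<length b. x = take k b)" for x
    using that(2)
  proof (elim disjE exE conjE)
    fix k assume "k < length a" "x = take k a"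
    then obtain p where "isleaf T p" "p \<noteq> a" "p \<noteq> b" "projR2 a b p = x"
      using ex_leaf_projecting[of k] nz by blast
    then show ?thesis using assms by force
  next
    fix k assume "k < length b" "x = take k b"
    then obtain p where "isleaf T p" "p \<noteq> a" "p \<noteq> b" "projR2 b a p = x"
      using ba.ex_leaf_projecting[of k] nz hang_commute[of T b a] by auto
    then show ?thesis using assms projR2_commute by force
  qed
  have "(\<Sum>v\<leftarrow>concat (cutblocks branches start_cuts ?ys). ?f v)
     = (\<Sum>z\<in>remaining branches start_cuts. ?f (vertex branches z))"
  proof (rule sum_cutblocks[OF branches_len _ inj_vertex])
    show "length start_cuts = length branches" by (simp add: start_cuts_def branches_def)
    show "\<forall>z\<in>remaining branches start_cuts. ?f (vertex branches z) \<noteq> 0 \<longrightarrow> vertex branches z \<in> set ?ys"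
    proof (intro ballI impI hit)
      fix z assume z: "z \<in> remaining branches start_cuts"
      then consider k where "k < L" "z = (0, k)" | k where "k < length a" "z = (Suc 0, k)"
        | k where "k < length b" "z = (2, k)" unfolding remaining_start by auto
      then show "(\<exists>k<length a. vertex branches z = take k a) \<or> (\<exists>k<length b. vertex branches z = take k b)"
      proof cases
        case (1 k)
        then show ?thesis using L_less_a by (intro disjI1 exI[of _ k]) simp
      qed auto
    qed auto
  qed
  moreover have "glue H {[], take L a} [[]] (cutblocks branches start_cuts ?ys) \<noteq> []"
    by (rule glue_nonempty) simp
  ultimately show ?thesis
    using sum_remaining_start[of "\<lambda>v. fleaves (H v)"]
    unfolding newtree_alt total_leaves by (simp add: nleaves_build fleaves_glue)
qed

text \<open>The conditions on Z treat Omega below the root, the root apart from Omega, and Omega at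
  the root. For trees without vertices of degree two Z is everything, as additional subtrees do no
  harm. In binary trees nothing hangs at either start point, so Z is \<open>{0}\<close> and joining
  changes no degree.\<close>

lemma (in two_leaves) rdegs_newtree:
  assumes T: "rdegs R N T" and N: "0 \<in> N"
    and Z: "\<And>z. Suc (Suc z) \<in> N \<Longrightarrow> z \<in> Z" "\<And>z. Suc z \<in> R \<Longrightarrow> z \<in> Z" "\<And>z. Suc (Suc z) \<in> R \<Longrightarrow> z \<in> Z"
    and add: "\<And>w z. Suc w \<in> N \<Longrightarrow> z \<in> Z \<Longrightarrow> Suc (w + z) \<in> N" "\<And>r z. Suc r \<in> R \<Longrightarrow> z \<in> Z \<Longrightarrow> Suc (r + z) \<in> R"
    and R: "Suc 0 \<in> R"
  shows "rdegs R N (newtree T a b \<sigma>)"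
proof -
  interpret ba: two_leaves T b a by (rule two_leaves_commute)
  have Lba: "ba.L = L" by (simp add: ba.L_def L_def lcp_commute)
  let ?bls = "cutblocks branches start_cuts (map (projR2 a b) \<sigma>)"
  let ?sp = "glue H {[], take L a} [[]] ?bls"
  define onpath where "onpath x \<longleftrightarrow> (\<exists>k<length a. x = take k a) \<or> (\<exists>k<length b. x = take k b)" for x
  have pos: "ispos T x" if "onpath x" for x
    using that ispos_take[OF pos_a] ispos_take[OF pos_b] by (auto simp: onpath_def)
  have len: "length (kids (sub T x)) = Suc (length (H x))" if "onpath x" "x \<noteq> take L a" for x
    using that length_kids_a ba.length_kids_a take_L Lba
    by (auto simp: onpath_def hang_commute[of T b a])
  have inN: "length (kids (sub T x)) \<in> N" if "onpath x" "x \<noteq> []" for x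
    using rdegs_sub[OF T pos[OF that(1)] that(2)] degs_kids by blast
  have inR: "length (kids (sub T [])) \<in> R" using T by (simp add: rdegs_def)
  have nonstart: "Suc (length (H x)) \<in> N" if "onpath x" "x \<notin> {[], take L a}" for x
    using inN[OF that(1)] len[OF that(1)] that(2) by auto
  have start: "length (H x) \<in> Z" if "onpath x" "x \<in> {[], take L a}" for x
  proof (cases "x = take L a")
    case True
    show ?thesis
    proof (cases "x = []")
      case 1: True
      then show ?thesis using True length_kids_L inR by (intro Z(3)) auto
    next
      case False
      then show ?thesis using True length_kids_L inN[OF that(1)] by (intro Z(1)) auto
    qed
  next
    case False
    then show ?thesis using that len[OF that(1)] inR by (intro Z(2)) auto
  qed
  have inv: "?sp \<noteq> [] \<and> length (hd ?sp) \<in> {r. Suc r \<in> R} \<and> (\<forall>hs\<in>set (tl ?sp). length hs \<in> {w. Suc w \<in> N})"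
  proof (rule glue_invariant)
    show "\<forall>bl\<in>set ?bls. \<exists>v vs. bl = v # vs \<and> (v \<in> {[], take L a} \<longrightarrow> length (H v) \<in> Z) \<and>
      (v \<notin> {[], take L a} \<longrightarrow> length (H v) \<in> {w. Suc w \<in> N}) \<and> (\<forall>x\<in>set vs. length (H x) \<in> {w. Suc w \<in> N})"
    proof
      fix bl assume "bl \<in> set ?bls"
      from cutblocks_branches[OF this] obtain v vs where bl: "bl = v # vs" "\<forall>x\<in>set bl. onpath x"
         "\<forall>x\<in>set vs. x \<notin> {[], take L a}" unfolding onpath_def by blast
      show "\<exists>v vs. bl = v # vs \<and> (v \<in> {[], take L a} \<longrightarrow> length (H v) \<in> Z) \<and>
          (v \<notin> {[], take L a} \<longrightarrow> length (H v) \<in> {w. Suc w \<in> N}) \<and> (\<forall>x\<in>set vs. length (H x) \<in> {w. Suc w \<in> N})"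
        using bl nonstart start by (intro exI[of _ v] exI[of _ vs]) simp
    qed
  qed (use add R in auto)
  have "degs N s" if "hs \<in> set ?sp" "s \<in> set hs" for hs s
  proof (rule glue_elems[OF _ _ _ that])
    show "\<forall>v\<in>set (concat ?bls). \<forall>s\<in>set (H v). degs N s"
    proof (intro ballI)
      fix v s assume v: "v \<in> set (concat ?bls)" "s \<in> set (H v)"
      then obtain bl where "bl \<in> set ?bls" "v \<in> set bl" by auto
      then have "onpath v" using cutblocks_branches[of bl] unfolding onpath_def by blast
      then show "degs N s" using degs_hang[OF T pos v(2)] by blast
    qed
  qed auto
  then show ?thesis unfolding newtree_alt using inv N by (intro rdegs_build) auto
qed

section \<open>The support of the one-step law\<close>

lemma ispos_repl: "ispos T v \<Longrightarrow> ispos (repl T v S) v \<and> sub (repl T v S) v = S"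
  by (induction T v rule: ispos.induct) auto

lemma isleaf_graft_left:
  assumes "ispos T v" "ispos (sub T v) p" "kids (sub (sub T v) p) = []"
  shows "isleaf (graft T v) (v @ 0 # p)"
  using assms by (simp add: graft_def isleaf_iff ispos_append sub_append ispos_repl)

lemma isleaf_graft_new: "ispos T v \<Longrightarrow> isleaf (graft T v) (v @ [Suc 0])"
  by (simp add: graft_def isleaf_iff ispos_append sub_append ispos_repl)

lemma finite_isleaf: "finite {p. isleaf T p}"
  by (rule finite_subset[OF _ finite_ispos[of T]]) (auto simp: isleaf_def)

lemma finite_edges: "finite (edges T)"
  by (rule finite_subset[OF _ finite_ispos[of T]]) (auto simp: edges_def)

lemma edges_nonempty: "nleaves (shape T) > 0 \<Longrightarrow> edges T \<noteq> {}"
proof -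
  assume "nleaves (shape T) > 0"
  then have "kids T \<noteq> []" by (auto simp: nleaves_shape)
  then have "[0] \<in> edges T" by (auto simp: edges_def ispos_Cons)
  then show ?thesis by blast
qed

text \<open>\<open>pmf_of_set\<close> has the intended support only on finite nonempty sets, so each
  choice must be shown possible. The grafted tree has two leaves to select: the new one and an end
  below the chosen edge.\<close>

lemma set_step:
  assumes "nleaves u > 0"
  shows "set_pmf (step u) = {shape (newtree (graft (rep u) v) a b \<sigma>) | v a b \<sigma>.
     v \<in> edges (rep u) \<and> two_leaves (graft (rep u) v) a b \<and>
     \<sigma> \<in> permutations_of_set ({p. isleaf (graft (rep u) v) p} - {a, b})}"
proof -
  let ?T = "rep u"
  have e: "finite (edges ?T)" "edges ?T \<noteq> {}"
    using finite_edges edges_nonempty[of ?T] assms by (simp_all add: shape_rep)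
  let ?P = "\<lambda>v. {(a, b). isleaf (graft ?T v) a \<and> isleaf (graft ?T v) b \<and> a \<noteq> b}"
  have P: "finite (?P v)" for v
    by (rule finite_subset[OF _ finite_cartesian_product[OF finite_isleaf finite_isleaf]]) auto
  have P': "?P v \<noteq> {}" if v: "v \<in> edges ?T" for v
  proof -
    have "ispos ?T v" using v by (simp add: edges_def)
    then show ?thesis
      using isleaf_graft_new[of ?T v] ex_end[of "sub ?T v"] isleaf_graft_left[of ?T v] by fastforce
  qed
  let ?S = "\<lambda>v a b. permutations_of_set ({p. isleaf (graft ?T v) p} - {a, b})"
  have S: "finite (?S v a b)" "?S v a b \<noteq> {}" for v a b
    using finite_isleaf by auto
  let ?K = "\<lambda>v a b \<sigma>. shape (newtree (graft ?T v) a b \<sigma>)"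
  have K: "set_pmf (bind_pmf (pmf_of_set (?S v a b)) (\<lambda>\<sigma>. return_pmf (?K v a b \<sigma>))) = ?K v a b ` ?S v a b"
    for v a b by (auto simp: set_pmf_of_set[OF S(2,1)])
  have inner: "set_pmf (bind_pmf (pmf_of_set (?P v)) (\<lambda>(a, b). bind_pmf (pmf_of_set (?S v a b))
      (\<lambda>\<sigma>. return_pmf (?K v a b \<sigma>)))) = (\<Union>(a, b)\<in>?P v. ?K v a b ` ?S v a b)" if "v \<in> edges ?T" for v
    unfolding set_bind_pmf set_pmf_of_set[OF P'[OF that] P]
    by (intro SUP_cong refl) (simp only: case_prod_unfold K)
  have *: "set_pmf (step u) = (\<Union>v\<in>edges ?T. \<Union>(a, b)\<in>?P v. ?K v a b ` ?S v a b)"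
    unfolding step_def Let_def by (subst set_bind_pmf, subst set_pmf_of_set[OF e(2,1)])
      (intro SUP_cong refl inner)
  show ?thesis
  proof (intro equalityI subsetI)
    fix y assume "y \<in> set_pmf (step u)"
    then obtain v a b \<sigma> where "v \<in> edges ?T" "(a, b) \<in> ?P v" "\<sigma> \<in> ?S v a b" "y = ?K v a b \<sigma>"
      unfolding * by auto
    then show "y \<in> {?K v a b \<sigma> | v a b \<sigma>. v \<in> edges ?T \<and> two_leaves (graft ?T v) a b \<and> \<sigma> \<in> ?S v a b}"
      unfolding two_leaves_def mem_Collect_eq case_prod_conv by metis
  next
    fix y assume "y \<in> {?K v a b \<sigma> | v a b \<sigma>. v \<in> edges ?T \<and> two_leaves (graft ?T v) a b \<and> \<sigma> \<in> ?S v a b}"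
    then obtain v a b \<sigma> where y: "v \<in> edges ?T" "two_leaves (graft ?T v) a b" "\<sigma> \<in> ?S v a b" "y = ?K v a b \<sigma>"
      by auto
    then have "(a, b) \<in> ?P v" by (simp add: two_leaves_def)
    then show "y \<in> set_pmf (step u)" unfolding * using y(1,3,4) by blast
  qed
qed

lemma nleaves_Tn_o: "u \<in> Tn_o n \<Longrightarrow> nleaves u = n"
  by (simp add: Tn_o_def)

lemma step_Tn_o:
  assumes "u \<in> Tn_o n" "n > 0" shows "set_pmf (step u) \<subseteq> Tn_o n"
proof
  fix y assume "y \<in> set_pmf (step u)"
  then obtain v a b \<sigma> where y: "y = shape (newtree (graft (rep u) v) a b \<sigma>)" "v \<in> edges (rep u)"
    "two_leaves (graft (rep u) v) a b" "\<sigma> \<in> permutations_of_set ({p. isleaf (graft (rep u) v) p} - {a, b})"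
    using assms by (auto simp: set_step nleaves_Tn_o)
  interpret two_leaves "graft (rep u) v" a b by (rule y)
  have T: "rdegs UNIV (- {1}) (rep u)" "nleaves (shape (rep u)) = n"
    using assms Tn_o_shape[of "rep u"] by (simp_all add: shape_rep)
  have "nleaves y = n"
    using nleaves_newtree[of \<sigma>] nleaves_graft[OF y(2)] T y by (simp add: permutations_of_set_def)
  moreover have "rdegs UNIV (- {1}) (newtree (graft (rep u) v) a b \<sigma>)"
    by (rule rdegs_newtree[where Z = UNIV]) (use rdegs_graft[OF _ _ y(2) T(1)] in auto)
  ultimately show "y \<in> Tn_o n" using y(1) Tn_o_shape by blast
qed

lemma Tn_bo_subset: "Tn_bo n \<subseteq> Tn_o n" by (auto simp: Tn_bo_def)

lemma step_Tn_bo: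
  assumes "u \<in> Tn_bo n" "n > 0" shows "set_pmf (step u) \<subseteq> Tn_bo n"
proof
  fix y assume "y \<in> set_pmf (step u)"
  moreover have "u \<in> Tn_o n" using assms Tn_bo_subset by blast
  ultimately obtain v a b \<sigma> where y: "y = shape (newtree (graft (rep u) v) a b \<sigma>)" "v \<in> edges (rep u)"
    "two_leaves (graft (rep u) v) a b" "\<sigma> \<in> permutations_of_set ({p. isleaf (graft (rep u) v) p} - {a, b})"
    using assms by (auto simp: set_step nleaves_Tn_o)
  interpret two_leaves "graft (rep u) v" a b by (rule y)
  have T: "rdegs {1} {0, 2} (rep u)" "nleaves (shape (rep u)) = n"
    using assms Tn_bo_shape[of "rep u"] by (simp_all add: shape_rep)
  have "nleaves y = n"
    using nleaves_newtree[of \<sigma>] nleaves_graft[OF y(2)] T y by (simp add: permutations_of_set_def)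
  moreover have "rdegs {1} {0, 2} (newtree (graft (rep u) v) a b \<sigma>)"
    by (rule rdegs_newtree[where Z = "{0}"]) (use rdegs_graft[OF _ _ y(2) T(1)] in auto)
  ultimately show "y \<in> Tn_bo n" using y(1) Tn_bo_shape by blast
qed

section \<open>Realising the moves\<close>

context two_leaves begin

lemma inbr_0: "k < length a \<Longrightarrow> inbr (take L a, L) c (take k a) \<longleftrightarrow> c \<le> k \<and> k < L"
  by (auto simp: inbr_def min_def)

lemma cutblocks_0:
  assumes "c0 \<le> k" "k < L"
  shows "cutblocks branches [c0, c1, c2] (take k a # ys) =
    map (\<lambda>k. take k a) [c0..<Suc k] # cutblocks branches [Suc k, c1, c2] ys"
proof -
  have "inbr (take L a, L) c0 (take k a)" using assms L_less_a by (simp add: inbr_0)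
  moreover have "[0..<length branches] = [0, 1, 2]" by (simp add: branches_def upt_rec)
  moreover have "map (\<lambda>k. take k (take L a)) [c0..<Suc k] = map (\<lambda>k. take k a) [c0..<Suc k]"
    using assms(2) by (intro map_cong) auto
  ultimately show ?thesis using assms L_less_a by (simp add: branches_def del: upt_Suc take_take)
qed

lemma cutblocks_1:
  assumes "L < c1" "c1 \<le> k" "k < length a"
  shows "cutblocks branches [c0, c1, c2] (take k a # ys) =
    map (\<lambda>k. take k a) [c1..<Suc k] # cutblocks branches [c0, Suc k, c2] ys"
proof -
  have "\<not> inbr (take L a, L) c0 (take k a)" using assms by (simp add: inbr_0)
  moreover have "inbr (a, length a) c1 (take k a)" using assms by (simp add: inbr_def)
  moreover have "[0..<length branches] = [0, 1, 2]" by (simp add: branches_def upt_rec)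
  ultimately show ?thesis using assms by (simp add: branches_def del: upt_Suc)
qed

text \<open>E_2 is tested before E_3, and the two paths agree up to depth L; \<open>L < c1\<close>
  keeps E_2 from claiming Omega.\<close>

lemma cutblocks_2:
  assumes "L < c1" "L \<le> c2" "c2 \<le> k" "k < length b"
  shows "cutblocks branches [c0, c1, c2] (take k b # ys) =
    map (\<lambda>k. take k b) [c2..<Suc k] # cutblocks branches [c0, c1, Suc k] ys"
proof -
  have "\<not> inbr (take L a, L) c0 (take k b)" using assms by (auto simp: inbr_def)
  moreover have "\<not> inbr (a, length a) c1 (take k b)"
    using assms take_eq_iff[of k] by (auto simp: inbr_def)
  moreover have "inbr (b, length b) c2 (take k b)" using assms by (simp add: inbr_def)
  moreover have "[0..<length branches] = [0, 1, 2]" by (simp add: branches_def upt_rec)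
  ultimately show ?thesis using assms by (simp add: branches_def del: upt_Suc)
qed

lemma cutblocks_exhausted:
  assumes "\<forall>y\<in>set ys. \<not> inbr (take L a, L) c0 y"
  shows "cutblocks branches [c0, length a, length b] ys = []"
  using assms
proof (induction ys)
  case (Cons y ys)
  have "[0..<length branches] = [0, 1, 2]" by (simp add: branches_def upt_rec)
  then show ?case using Cons by (simp add: branches_def inbr_def)
qed simp

text \<open>Omega shares the entry of its parent. For L = 0 there is no parent, and it shares the
  entry of the new root.\<close>

definition spine :: "otree list list" where
  "spine = (let sp = (if L = 0 then [[]] else map (\<lambda>k. H (take k a)) [0..<L])
    in butlast sp @ [last sp @ H (take L a)] @ map (\<lambda>k. H (take k b)) [Suc L..<length b]
       @ map (\<lambda>k. H (take k a)) [Suc L..<length a])"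

text \<open>If the label order hits the last vertex of \<open>E\<^sub>1\<close>, then that of \<open>E\<^sub>3\<close>, then that of
  \<open>E\<^sub>2\<close>, each branch becomes a single block.\<close>

lemma ex_order_spine:
  assumes E1: "2 \<le> L \<Longrightarrow> H (take (L - 1) a) \<noteq> []"
    and E2: "Suc L < length a \<Longrightarrow> H (take (length a - 1) a) \<noteq> []"
    and E3: "H (take (length b - 1) b) \<noteq> []"
  shows "\<exists>\<sigma>\<in>permutations_of_set ({p. isleaf T p} - {a, b}). newtree T a b \<sigma> = build spine"
proof -
  interpret ba: two_leaves T b a by (rule two_leaves_commute)
  let ?A = "{p. isleaf T p} - {a, b}"
  \<comment> \<open>This fails only if E_1 is empty or a single root with nothing hanging. Then no
    block arises on E_1, and the entry with which \<open>glue\<close> starts stands for the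
    root.\<close>
  define hit1 where "hit1 \<longleftrightarrow> L > 0 \<and> H (take (L - 1) a) \<noteq> []"
  define hit2 where "hit2 \<longleftrightarrow> Suc L < length a"
  have no_hit1: "L = 0 \<or> (L = 1 \<and> H [] = [])" if "\<not> hit1"
  proof (cases "2 \<le> L")
    case True
    then show ?thesis using E1 that by (auto simp: hit1_def)
  next
    case False
    then have "L = 0 \<or> L = 1" by auto
    then show ?thesis using that by (auto simp: hit1_def)
  qed
  obtain p1 where p1: "hit1 \<Longrightarrow> p1 \<in> ?A \<and> projR2 a b p1 = take (L - 1) a"
    using ex_leaf_projecting[of "L - 1"] L_less_a unfolding hit1_def mem_Collect_eq Diff_iff insert_iff empty_iff
    by (metis less_imp_diff_less)
  obtain p2 where p2: "hit2 \<Longrightarrow> p2 \<in> ?A \<and> projR2 a b p2 = take (length a - 1) a"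
    using ex_leaf_projecting[of "length a - 1"] E2 L_less_a unfolding hit2_def mem_Collect_eq Diff_iff insert_iff empty_iff
    by (metis diff_less less_nat_zero_code neq0_conv zero_less_one)
  obtain p3 where p3: "p3 \<in> ?A" "projR2 a b p3 = take (length b - 1) b"
  proof -
    have "length b - 1 < length b" using L_less_b by auto
    then show thesis
      using ba.ex_leaf_projecting[of "length b - 1"] E3 hang_commute[of T b a] projR2_commute that by auto
  qed
  define ps where "ps = (if hit1 then [p1] else []) @ [p3] @ (if hit2 then [p2] else [])"
  have "take (L - 1) a \<noteq> take (length b - 1) b" if hit1
  proof
    assume "take (L - 1) a = take (length b - 1) b"
    from arg_cong[OF this, of length] have "L - 1 = length b - 1" using L_less_a by simp
    then show False using that L_less_b unfolding hit1_def by linarith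
  qed
  moreover have "take (L - 1) a \<noteq> take (length a - 1) a" if hit1 hit2
  proof
    assume "take (L - 1) a = take (length a - 1) a"
    from arg_cong[OF this, of length] have "L - 1 = length a - 1" using L_less_a by simp
    then show False using that L_less_a unfolding hit1_def hit2_def by linarith
  qed
  moreover have "take (length b - 1) b \<noteq> take (length a - 1) a" if hit2
  proof
    assume *: "take (length b - 1) b = take (length a - 1) a"
    from arg_cong[OF this, of length] have "length b - 1 = length a - 1" by simp
    then have len: "length b = length a" using L_less_a L_less_b by linarith
    moreover have "length a - 1 > L" using that unfolding hit2_def by linarith
    ultimately show False using * take_eq_iff[of "length a - 1"] by simp
  qed
  ultimately have ps: "distinct ps" "set ps \<subseteq> ?A"
    using p1 p2 p3 by (auto simp: ps_def)
  have "finite (?A - set ps)" using finite_isleaf[of T] by simp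
  then obtain rs where rs: "set rs = ?A - set ps" "distinct rs" using finite_distinct_list by blast
  define \<sigma> where "\<sigma> = ps @ rs"
  have \<sigma>: "\<sigma> \<in> permutations_of_set ?A" using ps rs by (auto simp: permutations_of_set_def \<sigma>_def)
  define ys where "ys = map (projR2 a b) rs"
  define c0 where "c0 = (if hit1 then L else 0)"
  \<comment> \<open>The other labels create no block on E_1: it is used up, empty, or a bare root,
    and projections hit only vertices at which something hangs.\<close>
  have done': "\<forall>y\<in>set ys. \<not> inbr (take L a, L) c0 y"
  proof (cases "hit1 \<or> L = 0")
    case True then show ?thesis by (auto simp: inbr_def c0_def)
  next
    case False
    then have L: "L = 1" "H [] = []" using no_hit1 by auto
    have "y \<noteq> []" if "y \<in> set ys" for y
    proof -
      obtain p where "p \<in> ?A" "y = projR2 a b p" using \<open>y \<in> set ys\<close> rs(1) by (auto simp: ys_def)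
      then have "H y \<noteq> []" using hang_projR2_nonempty[of p] by simp
      then show ?thesis using L(2) by auto
    qed
    then show ?thesis by (auto simp: inbr_def L)
  qed
  define B1 where "B1 = (if hit1 then [map (\<lambda>k. take k a) [0..<L]] else [])"
  define B2 where "B2 = (if hit2 then [map (\<lambda>k. take k a) [Suc L..<length a]] else [])"
  let ?B3 = "map (\<lambda>k. take k b) [L..<length b]"
  define z2 where "z2 = (if hit2 then [take (length a - 1) a] else []) @ ys"
  define z1 where "z1 = take (length b - 1) b # z2"
  have z: "map (projR2 a b) \<sigma> = (if hit1 then [take (L - 1) a] else []) @ z1"
    using p1 p2 p3 by (simp add: \<sigma>_def ps_def ys_def z1_def z2_def)
  have 1: "cutblocks branches [0, Suc L, L] (map (projR2 a b) \<sigma>) =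
      B1 @ cutblocks branches [c0, Suc L, L] z1"
  proof (cases hit1)
    case True
    then have "Suc (L - 1) = L" "L - 1 < L" by (auto simp: hit1_def)
    then show ?thesis using True cutblocks_0[of 0 "L - 1" "Suc L" L z1]
      unfolding z by (simp add: B1_def c0_def del: upt_Suc cutblocks.simps)
  next
    case False
    then show ?thesis unfolding z by (simp add: B1_def c0_def del: cutblocks.simps)
  qed
  have "Suc (length b - 1) = length b" "L \<le> length b - 1" "length b - 1 < length b" using L_less_b by auto
  then have 2: "cutblocks branches [c0, Suc L, L] z1 = ?B3 # cutblocks branches [c0, Suc L, length b] z2"
    unfolding z1_def using cutblocks_2[of "Suc L" L "length b - 1" c0 z2]
    by (simp del: upt_Suc cutblocks.simps)
  have 3: "cutblocks branches [c0, Suc L, length b] z2 = B2 @ cutblocks branches [c0, length a, length b] ys"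
  proof (cases hit2)
    case True
    then have "Suc (length a - 1) = length a" "Suc L \<le> length a - 1" "length a - 1 < length a"
      by (auto simp: hit2_def)
    then show ?thesis using True cutblocks_1[of "Suc L" "length a - 1" c0 "length b" ys]
      by (simp add: B2_def z2_def del: upt_Suc cutblocks.simps)
  next
    case False
    then have "length a = Suc L" using L_less_a by (simp add: hit2_def)
    then show ?thesis using False by (simp add: B2_def z2_def del: cutblocks.simps)
  qed
  have blocks: "cutblocks branches start_cuts (map (projR2 a b) \<sigma>) = B1 @ ?B3 # B2"
    using 1 2 3 cutblocks_exhausted[OF done'] by (simp add: start_cuts_def del: upt_Suc)
  let ?St = "{[], take L a}"
  have glue_append: "glue h St sp (xs @ zs) = glue h St (glue h St sp xs) zs" for h St sp xs zs
    by (induction xs arbitrary: sp) auto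
  let ?sp1 = "if L = 0 then [[]] else map (\<lambda>k. H (take k a)) [0..<L]"
  have sp1: "glue H ?St [[]] B1 = ?sp1"
  proof (cases hit1)
    case True
    then have "[0..<L] = 0 # [Suc 0..<L]" by (simp add: hit1_def upt_conv_Cons)
    then show ?thesis using True by (simp add: B1_def hit1_def)
  next
    case False
    then have "L = 0 \<or> (L = 1 \<and> H [] = [])" by (rule no_hit1)
    then show ?thesis using False by (auto simp: B1_def)
  qed
  have "[L..<length b] = L # [Suc L..<length b]" using L_less_b by (simp add: upt_conv_Cons)
  then have sp3: "glue H ?St ?sp1 [?B3] =
      butlast ?sp1 @ [last ?sp1 @ H (take L a)] @ map (\<lambda>k. H (take k b)) [Suc L..<length b]"
    using take_L by (simp add: comp_def)
  have sp2: "glue H ?St sp B2 = sp @ map (\<lambda>k. H (take k a)) [Suc L..<length a]" for sp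
  proof (cases hit2)
    case True
    then have u: "[Suc L..<length a] = Suc L # [Suc (Suc L)..<length a]"
      by (simp add: hit2_def upt_conv_Cons)
    have "length (take (Suc L) a) = Suc L" "length (take L a) = L" using L_less_a by auto
    then have "take (Suc L) a \<notin> ?St" by (metis insertE length_0_conv nat.distinct(1) n_not_Suc_n singletonD)
    then show ?thesis using True unfolding B2_def u by (simp add: comp_def)
  next
    case False
    then show ?thesis by (simp add: B2_def hit2_def)
  qed
  have "glue H ?St [[]] (B1 @ [?B3] @ B2) = spine"
    unfolding glue_append sp1 sp3 sp2 by (simp add: spine_def Let_def)
  then have "newtree T a b \<sigma> = build spine" unfolding newtree_alt blocks by simp
  then show ?thesis using \<sigma> by blast
qed

lemma kids_ge2:
  assumes "rdegs UNIV (- {1}) T" "0 < k" "k < length a"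
  shows "length (kids (sub T (take k a))) \<ge> 2"
proof -
  have "degs (- {1}) (sub T (take k a))"
    using rdegs_sub[OF assms(1) ispos_take[OF pos_a]] assms by force
  from degs_kids[THEN iffD1, OF this] have "length (kids (sub T (take k a))) \<noteq> 1" by auto
  moreover have "length (kids (sub T (take k a))) > 0" using nth_less_kids[OF pos_a assms(3)] by auto
  ultimately show ?thesis by linarith
qed

lemma H_nonempty:
  assumes "rdegs UNIV (- {1}) T" "0 < k" "k < length a" "k \<noteq> L"
  shows "H (take k a) \<noteq> []"
  using kids_ge2[OF assms(1-3)] length_kids_a[OF assms(3,4)] by auto

text \<open>Without vertices of degree two something hangs at every path vertex other than the root
  and Omega. The bound on \<open>length b\<close> ensures that the last vertex of E_3 is not
  Omega.\<close>

lemma ex_order_spine':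
  assumes "rdegs UNIV (- {1}) T" "Suc L < length b"
  shows "\<exists>\<sigma>\<in>permutations_of_set ({p. isleaf T p} - {a, b}). newtree T a b \<sigma> = build spine"
proof (rule ex_order_spine)
  interpret ba: two_leaves T b a by (rule two_leaves_commute)
  have Lba: "ba.L = L" by (simp add: ba.L_def L_def lcp_commute)
  show "H (take (L - 1) a) \<noteq> []" if "2 \<le> L" using that L_less_a by (intro H_nonempty assms) auto
  show "H (take (length a - 1) a) \<noteq> []" if "Suc L < length a" using that by (intro H_nonempty assms) auto
  show "H (take (length b - 1) b) \<noteq> []"
    using ba.H_nonempty[OF assms(1), of "length b - 1"] assms(2) by (simp add: Lba hang_commute[of T b a])
qed

text \<open>\<open>build\<close> puts the path child last, while in T it stands at its own index; so
  a stretch of the path avoiding Omega is recovered only up to \<open>shape\<close>.\<close>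

lemma shape_build_path:
  assumes "m \<le> n" "n \<le> length a" "L < m \<or> n \<le> L"
  shows "shape (build (map (\<lambda>k. H (take k a)) [m..<n] @ X)) =
    shape (repl (sub T (take m a)) (drop m (take n a)) (build X))"
  using assms(1,3)
proof (induction m rule: inc_induct)
  case (step m)
  let ?S = "sub T (take m a)" and ?Z = "repl (sub T (take (Suc m) a)) (drop (Suc m) (take n a)) (build X)"
  have ma: "m < length a" using step assms by simp
  have dr: "drop m (take n a) = a ! m # drop (Suc m) (take n a)"
    using step ma by (subst Cons_nth_drop_Suc[symmetric]) auto
  have mL: "m \<noteq> L" using step by auto
  have am: "a ! m < length (kids ?S)" by (rule nth_less_kids[OF pos_a ma])
  have sb: "sub T (take (Suc m) a) = kids ?S ! (a ! m)" by (rule sub_take_Suc[OF pos_a ma])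
  have "mset (map shape (kids ?S)) = add_mset (shape (kids ?S ! (a ! m))) (mset (map shape (H (take m a))))"
    using mset_hang_a[OF ma mL] sb by simp
  then have "mset (map shape ((kids ?S)[a ! m := ?Z])) = add_mset (shape ?Z) (mset (map shape (H (take m a))))"
    using am by (simp only: map_update) (simp add: mset_update)
  moreover have "repl ?S (drop m (take n a)) (build X) = ONd ((kids ?S)[a ! m := ?Z])"
    unfolding dr sb[symmetric] using am sb by (simp add: kids_repl_Cons)
  moreover have "[m..<n] = m # [Suc m..<n]" using step by (simp add: upt_conv_Cons)
  moreover have "shape (build (map (\<lambda>k. H (take k a)) [Suc m..<n] @ X)) = shape ?Z" using step by auto
  ultimately show ?case by (simp add: shape_kids[of "ONd _"])
qed simp

end

lemma repl_sub_self: "ispos T p \<Longrightarrow> repl T p (sub T p) = T"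
  by (induction T p rule: ispos.induct) auto

lemma repl_repl: "ispos T p \<Longrightarrow> repl (repl T p X) p Y = repl T p Y"
  by (induction T p rule: ispos.induct) auto

lemma repl_append: "ispos T p \<Longrightarrow> repl T (p @ q) S = repl T p (repl (sub T p) q S)"
  by (induction T p rule: ispos.induct) auto

lemma sub_repl_append: "ispos T p \<Longrightarrow> sub (repl T p X) (p @ q) = sub X q"
  using ispos_repl[of T p X] by (simp add: sub_append)

lemma ispos_repl_append: "ispos T p \<Longrightarrow> ispos (repl T p X) (p @ q) \<longleftrightarrow> ispos X q"
  using ispos_repl[of T p X] by (simp add: ispos_append)

lemma shape_repl_cong: "ispos T p \<Longrightarrow> shape S = shape S' \<Longrightarrow> shape (repl T p S) = shape (repl T p S')"
proof (induction p arbitrary: T)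
  case (Cons i p)
  then have i: "i < length (kids T)" "ispos (kids T ! i) p" by (auto simp: ispos_Cons)
  have "shape (repl (kids T ! i) p S) = shape (repl (kids T ! i) p S')" using Cons.IH[OF i(2) Cons.prems(2)] .
  then show ?case using i(1) by (simp only: kids_repl_Cons shape_kids[of "ONd _"] kids_ONd map_update)
qed simp

context two_leaves begin

text \<open>Y is the subtree at Omega containing b, with the leaf b replaced by the whole subtree
  containing a. The spine ends in Y because E_2 followed by Sigma_1 reproduces that second
  subtree.\<close>

lemma shape_build_spine:
  defines "Y \<equiv> repl (sub T (take (Suc L) b)) (drop (Suc L) b) (sub T (take (Suc L) a))"
  shows "L = 0 \<Longrightarrow> shape (build spine) = shape (ONd (H (take L a) @ [Y]))"
    and "0 < L \<Longrightarrow> shape (build spine) =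
      shape (repl T (take (L - 1) a) (ONd (H (take (L - 1) a) @ H (take L a) @ [Y])))"
proof -
  interpret ba: two_leaves T b a by (rule two_leaves_commute)
  have Lba: "ba.L = L" by (simp add: ba.L_def L_def lcp_commute)
  let ?E2 = "map (\<lambda>k. H (take k a)) [Suc L..<length a]" and ?E3 = "map (\<lambda>k. H (take k b)) [Suc L..<length b]"
  have pa: "ispos (sub T (take (Suc L) a)) (drop (Suc L) a)" and pb: "ispos (sub T (take (Suc L) b)) (drop (Suc L) b)"
    using pos_a pos_b by (metis append_take_drop_id ispos_append)+
  \<comment> \<open>The final leaf of the spine is what stands at a already, so along E_2 a subtree
    is replaced by itself.\<close>
  have "ONd [] = sub T a" using leaf_a by (metis ONd_kids isleaf_iff)
  also have "\<dots> = sub (sub T (take (Suc L) a)) (drop (Suc L) a)"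
    using sub_append[OF ispos_take[OF pos_a], of "Suc L" "drop (Suc L) a"] by simp
  finally have e: "build [] = sub (sub T (take (Suc L) a)) (drop (Suc L) a)" by simp
  have "shape (build ?E2) = shape (repl (sub T (take (Suc L) a)) (drop (Suc L) a) (build []))"
    using shape_build_path[of "Suc L" "length a" "[]"] L_less_a by simp
  then have 2: "shape (build ?E2) = shape (sub T (take (Suc L) a))"
    unfolding e by (simp add: repl_sub_self[OF pa])
  have "shape (build (?E3 @ ?E2)) = shape (repl (sub T (take (Suc L) b)) (drop (Suc L) b) (build ?E2))"
    using ba.shape_build_path[of "Suc L" "length b" ?E2] L_less_b Lba by (simp add: hang_commute[of T b a])
  also have "\<dots> = shape Y" unfolding Y_def by (rule shape_repl_cong[OF pb 2])
  finally have Y: "shape (build (?E3 @ ?E2)) = shape Y" .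
  have *: "shape (build ((K @ [])# ?E3 @ ?E2)) = shape (ONd (K @ [Y]))" for K
    using Y by (simp add: shape_kids[of "ONd _"])
  show "shape (build spine) = shape (ONd (H (take L a) @ [Y]))" if "L = 0"
    using that *[of "H (take L a)"] by (simp add: spine_def)
  assume L: "0 < L"
  have u: "[0..<L] = [0..<L - 1] @ [L - 1]" using L by (metis Suc_diff_1 le0 upt_Suc_append)
  have sp: "spine = map (\<lambda>k. H (take k a)) [0..<L - 1] @ ((H (take (L - 1) a) @ H (take L a)) # ?E3 @ ?E2)"
    using L unfolding spine_def u by simp
  have "shape (build spine) = shape (repl T (take (L - 1) a) (build ((H (take (L - 1) a) @ H (take L a)) # ?E3 @ ?E2)))"
    unfolding sp using shape_build_path[of 0 "L - 1"] L_less_a by simp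
  also have "\<dots> = shape (repl T (take (L - 1) a) (ONd (H (take (L - 1) a) @ H (take L a) @ [Y])))"
    using *[of "H (take (L - 1) a) @ H (take L a)"] by (intro shape_repl_cong ispos_take[OF pos_a]) simp
  finally show "shape (build spine) =
      shape (repl T (take (L - 1) a) (ONd (H (take (L - 1) a) @ H (take L a) @ [Y])))" .
qed

end

section \<open>Planting as a single transition\<close>

lemma lcp_append: "lcp (v @ x) (v @ y) = v @ lcp x y"
  by (induction v) auto

text \<open>Carries a hanging list back from the grafted tree to the original one: only the entry
  containing the new leaf has changed.\<close>

lemma mset_eq_of_update:
  assumes "i < length xs" "mset (xs[i := y]) = add_mset y N"
  shows "mset xs = add_mset (xs ! i) N"
proof -
  have "mset xs - {#xs ! i#} = N" using assms by (simp add: mset_update)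
  moreover have "xs ! i \<in># mset xs" using assms(1) by simp
  ultimately show ?thesis by (metis insert_DiffM)
qed

text \<open>v is the position of Omega, i selects A, and j followed by q is the chosen edge of B.
  The lists hs at Omega and gs at its parent matter only up to order, hence the multiset equations.
  The two conclusions separate Omega at the root from Omega with a parent w.\<close>

lemma planting_step:
  assumes val: "rdegs UNIV (- {1}) (rep u)" and nl: "nleaves u > 0"
    and pi: "ispos (rep u) (v @ [i])" and pj: "ispos (rep u) (v @ j # q)" and ij: "i \<noteq> j"
  defines "ts \<equiv> kids (sub (rep u) v)"
  defines "X \<equiv> repl (ts ! j) q (ONd [sub (ts ! j) q, ts ! i])"
  shows "\<exists>hs. mset ts = mset (ts ! i # ts ! j # hs) \<and>
    (v = [] \<longrightarrow> shape (ONd (hs @ [X])) \<in> set_pmf (step u)) \<and>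
    (\<forall>w m. v = w @ [m] \<longrightarrow> (\<exists>gs. mset (kids (sub (rep u) w)) = mset (sub (rep u) v # gs) \<and>
       shape (repl (rep u) w (ONd (gs @ hs @ [X]))) \<in> set_pmf (step u)))"
proof -
  let ?T0 = "rep u"
  define B where "B = ts ! j"
  define A where "A = ts ! i"
  define T where "T = graft ?T0 (v @ j # q)"
  define U where "U = ONd (ts[j := graft B q])"
  have v: "ispos ?T0 v" using pi by (simp add: ispos_append)
  have i: "i < length ts" using pi v by (simp add: ispos_snoc ts_def)
  have j: "j < length ts" "ispos B q" using pj v by (auto simp: ispos_append ispos_Cons ts_def B_def)
  have TU: "T = repl ?T0 v U"
    using v j(1) by (simp add: T_def graft_def repl_append sub_append sub_Cons kids_repl_Cons U_def B_def ts_def)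
  \<comment> \<open>Any end of A may serve as Sigma_1; the lost leaf is the new one, which
    \<open>graft\<close> puts at index 1.\<close>
  obtain p where p: "ispos A p" "kids (sub A p) = []" using ex_end by blast
  define a where "a = v @ i # p"
  define b where "b = v @ j # q @ [Suc 0]"
  have Ui: "kids U ! i = A" using ij by (simp add: U_def A_def)
  have Uj: "kids U ! j = graft B q" using j by (simp add: U_def)
  have lenU: "length (kids U) = length ts" by (simp add: U_def)
  have la: "isleaf T a"
    unfolding TU a_def isleaf_iff using p i Ui lenU
    by (simp add: ispos_repl_append[OF v] sub_repl_append[OF v] ispos_Cons sub_Cons)
  have "isleaf (graft B q) (q @ [Suc 0])" by (rule isleaf_graft_new[OF j(2)])
  then have lb: "isleaf T b"
    unfolding TU b_def isleaf_iff using j Uj lenU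
    by (simp add: ispos_repl_append[OF v] sub_repl_append[OF v] ispos_Cons sub_Cons)
  interpret two_leaves T a b using la lb ij by unfold_locales (auto simp: a_def b_def)
  have L: "L = length v" unfolding L_def unfolding a_def b_def lcp_append using ij by simp
  have tk: "take L a = v" "take (Suc L) a = v @ [i]" "take (Suc L) b = v @ [j]" "drop (Suc L) b = q @ [Suc 0]"
    "Suc L < length b" unfolding L unfolding a_def b_def by simp_all
  have sv: "sub T v = U" using ispos_repl[OF v] by (simp add: TU)
  have si: "sub T (v @ [i]) = A" and sj: "sub T (v @ [j]) = graft B q"
    using Ui Uj by (simp_all add: TU sub_repl_append[OF v] sub_Cons)
  \<comment> \<open>Replacing the new leaf by A after grafting amounts to planting A on the edge
    directly.\<close>
  have Y: "repl (graft B q) (q @ [Suc 0]) A = X"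
    using j(2) ispos_repl[OF j(2)] by (simp add: graft_def repl_append repl_repl X_def A_def B_def)
  have edge: "v @ j # q \<in> edges ?T0" using pj by (simp add: edges_def)
  have valT: "rdegs UNIV (- {1}) T" unfolding T_def by (rule rdegs_graft[OF _ _ edge val]) auto
  obtain \<sigma> where \<sigma>: "\<sigma> \<in> permutations_of_set ({p. isleaf T p} - {a, b})" "newtree T a b \<sigma> = build spine"
    using ex_order_spine'[OF valT tk(5)] by blast
  have st: "shape (build spine) \<in> set_pmf (step u)"
    unfolding set_step[OF nl] mem_Collect_eq
    by (intro exI[of _ "v @ j # q"] exI[of _ a] exI[of _ b] exI[of _ \<sigma>])
      (use edge \<sigma> two_leaves_axioms in \<open>simp add: T_def\<close>)
  let ?hs = "H v"
  have "mset (ts[j := graft B q]) = add_mset (graft B q) (add_mset A (mset ?hs))"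
    using mset_hang_L unfolding tk sv si sj by (simp add: U_def add_mset_commute)
  then have hs: "mset ts = mset (ts ! i # ts ! j # ?hs)"
    using mset_eq_of_update[OF j(1)] by (simp add: A_def add_mset_commute)
  have "shape (ONd (?hs @ [X])) \<in> set_pmf (step u)" if "v = []"
    using st shape_build_spine(1) that unfolding tk si sj Y by (simp add: L)
  moreover have "\<exists>gs. mset (kids (sub ?T0 w)) = mset (sub ?T0 v # gs) \<and>
       shape (repl ?T0 w (ONd (gs @ ?hs @ [X]))) \<in> set_pmf (step u)" if w: "v = w @ [m]" for w m
  proof -
    have pw: "ispos ?T0 w" and m: "m < length (kids (sub ?T0 w))" using v w by (simp_all add: ispos_snoc)
    have Tw: "T = repl ?T0 w (ONd ((kids (sub ?T0 w))[m := U]))"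
      using pw m by (simp add: TU w repl_append kids_repl_Cons)
    have L0: "0 < L" "L - 1 < length a" "L - 1 \<noteq> L" "Suc (L - 1) = L" "take (L - 1) a = w"
      unfolding L unfolding a_def w by auto
    have sw: "sub T w = ONd ((kids (sub ?T0 w))[m := U])" using ispos_repl[OF pw] by (simp add: Tw)
    have "mset ((kids (sub ?T0 w))[m := U]) = add_mset U (mset (H w))"
      using mset_hang_a[OF L0(2,3)] unfolding L0(4,5) tk(1) sv sw by simp
    from mset_eq_of_update[OF m this]
    have "mset (kids (sub ?T0 w)) = mset (sub ?T0 v # H w)" using pw by (simp add: w sub_snoc)
    moreover have "repl T w Z = repl ?T0 w Z" for Z unfolding Tw by (rule repl_repl[OF pw])
    then have "shape (repl ?T0 w (ONd (H w @ ?hs @ [X]))) \<in> set_pmf (step u)"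
      using st shape_build_spine(2)[OF L0(1)] unfolding tk si sj Y L0(5) by simp
    ultimately show ?thesis by blast
  qed
  ultimately show ?thesis using hs by blast
qed

section \<open>From moves to positions in a planar tree\<close>

lemma mset_map_update:
  assumes "i < length ts" "mset (map shape ts) = add_mset (shape (ts ! i)) N"
  shows "mset (map shape (ts[i := t])) = add_mset (shape t) N"
  using assms by (simp add: map_update mset_update)

lemma mset_map_nth:
  assumes "mset (map f ts) = add_mset s N" shows "\<exists>i<length ts. f (ts ! i) = s"
proof -
  have "s \<in> set (map f ts)" using assms by (metis set_mset_mset union_single_eq_member)
  then show ?thesis by (auto simp: in_set_conv_nth)
qed

text \<open>The indices must differ even when s = t, as for two isomorphic subtrees. The
  decomposition is therefore pulled back to the multiset of indices, in which each occurs
  once.\<close>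

lemma mset_map_nth2:
  assumes "mset (map f ts) = add_mset s (add_mset t N)"
  shows "\<exists>i j. i < length ts \<and> j < length ts \<and> i \<noteq> j \<and> f (ts ! i) = s \<and> f (ts ! j) = t"
proof -
  have "map (\<lambda>i. f (ts ! i)) [0..<length ts] = map f ts" by (rule nth_equalityI) auto
  then have "image_mset (\<lambda>i. f (ts ! i)) (mset [0..<length ts]) = add_mset s (add_mset t N)"
    using assms by (metis mset_map)
  from msed_map_invR[OF this] obtain i M where i: "mset [0..<length ts] = add_mset i M" "f (ts ! i) = s"
    and M: "image_mset (\<lambda>i. f (ts ! i)) M = add_mset t N" by blast
  from msed_map_invR[OF M] obtain j M' where j: "M = add_mset j M'" "f (ts ! j) = t" by blast
  have ij: "mset [0..<length ts] = add_mset i (add_mset j M')" using i(1) j(1) by simp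
  have "i \<noteq> j"
  proof
    assume "i = j"
    then have "count (mset [0..<length ts]) i \<ge> 2" unfolding ij by simp
    then show False using distinct_count_atmost_1[of "[0..<length ts]"] by (simp split: if_splits)
  qed
  moreover have "i \<in> set [0..<length ts]" "j \<in> set [0..<length ts]"
    unfolding set_mset_mset[symmetric] ij by simp_all
  ultimately show ?thesis using i(2) j(2) by auto
qed

lemma ins_position:
  assumes "ins A B X" "shape S = B" "shape A' = A"
  shows "\<exists>q. ispos S q \<and> shape (repl S q (ONd [sub S q, A'])) = X"
  using assms(1,2)
proof (induction arbitrary: S rule: ins.induct)
  case (top B)
  then show ?case using assms(3) by (intro exI[of _ "[]"]) (simp add: shape_kids[of "ONd _"] add_mset_commute)
next
  case (down s s' N)
  have M: "mset (map shape (kids S)) = add_mset s N" using down.prems shape_kids[of S] by simp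
  then obtain i where i: "i < length (kids S)" "shape (kids S ! i) = s" using mset_map_nth[OF M] by blast
  obtain q where q: "ispos (kids S ! i) q" "shape (repl (kids S ! i) q (ONd [sub (kids S ! i) q, A'])) = s'"
    using down.IH[OF i(2)] by blast
  have "shape (repl S (i # q) (ONd [sub S (i # q), A'])) = UNd (add_mset s' N)"
    using mset_map_update[OF i(1), of N] M i q(2)
    by (simp add: kids_repl_Cons sub_Cons shape_kids[of "ONd _"] del: mset_map)
  then show ?case using q(1) i(1) by (intro exI[of _ "i # q"]) (simp add: ispos_Cons)
qed

text \<open>The positions of Omega and of the edge are fixed first, while
  \<open>planting_step\<close> produces the hanging lists itself; so the conclusion must hold for
  all gs and hs with the right multisets.\<close>

lemma move_position:
  assumes "move M M'" "mset (map shape (kids T)) = M"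
  shows "\<exists>w m i j q. ispos T (w @ [m, i]) \<and> ispos T (w @ m # j # q) \<and> i \<noteq> j \<and>
    (\<forall>gs hs. let ts = kids (sub T (w @ [m])) in
      mset ts = mset (ts ! i # ts ! j # hs) \<longrightarrow> mset (kids (sub T w)) = mset (sub T (w @ [m]) # gs) \<longrightarrow>
      mset (map shape (kids (repl T w (ONd (gs @ hs @ [repl (ts ! j) q (ONd [sub (ts ! j) q, ts ! i])]))))) = M')"
  using assms
proof (induction arbitrary: T rule: move.induct)
  case (loc A B X H G)
  from mset_map_nth[OF loc.prems] obtain m where
    m: "m < length (kids T)" "shape (kids T ! m) = UNd (add_mset A (add_mset B H))" by blast
  define ts where "ts = kids (kids T ! m)"
  have ts: "mset (map shape ts) = add_mset A (add_mset B H)"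
    using m(2) shape_kids[of "kids T ! m"] by (simp add: ts_def)
  from mset_map_nth2[OF ts] obtain i j where
    ij: "i < length ts" "j < length ts" "i \<noteq> j" "shape (ts ! i) = A" "shape (ts ! j) = B" by blast
  obtain q where q: "ispos (ts ! j) q" "shape (repl (ts ! j) q (ONd [sub (ts ! j) q, ts ! i])) = X"
    using ins_position[OF loc.hyps ij(5,4)] by blast
  show ?case
  proof (rule exI[of _ "[]"], rule exI[of _ m], rule exI[of _ i], rule exI[of _ j], rule exI[of _ q],
      intro conjI allI)
    show "ispos T ([] @ [m, i])" "ispos T ([] @ m # j # q)" "i \<noteq> j"
      using m ij q by (simp_all add: ispos_Cons ts_def)
    fix gs hs
    have sm: "kids (sub T ([] @ [m])) = ts" by (simp add: sub_Cons ts_def)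
    have "mset (map shape hs) = H" if "mset ts = mset (ts ! i # ts ! j # hs)"
      using arg_cong[OF that, of "image_mset shape"] ts ij by simp
    moreover have "mset (map shape gs) = G" if "mset (kids T) = mset (kids T ! m # gs)"
      using arg_cong[OF that, of "image_mset shape"] loc.prems m by simp
    ultimately show "let ts = kids (sub T ([] @ [m])) in
      mset ts = mset (ts ! i # ts ! j # hs) \<longrightarrow> mset (kids (sub T [])) = mset (sub T ([] @ [m]) # gs) \<longrightarrow>
      mset (map shape (kids (repl T [] (ONd (gs @ hs @ [repl (ts ! j) q (ONd [sub (ts ! j) q, ts ! i])])))))
        = add_mset X (H + G)"
      unfolding Let_def sm using q(2) by (auto simp: sub_Cons)
  qed
next
  case (cong N N' G)
  from mset_map_nth[OF cong.prems] obtain k where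
    k: "k < length (kids T)" "shape (kids T ! k) = UNd N" by blast
  have "mset (map shape (kids (kids T ! k))) = N" using k(2) shape_kids[of "kids T ! k"] by simp
  from cong.IH[OF this] obtain w m i j q where w: "ispos (kids T ! k) (w @ [m, i])"
    "ispos (kids T ! k) (w @ m # j # q)" "i \<noteq> j" and
    res: "\<And>gs hs ts. ts = kids (sub (kids T ! k) (w @ [m])) \<Longrightarrow>
      mset ts = mset (ts ! i # ts ! j # hs) \<Longrightarrow>
      mset (kids (sub (kids T ! k) w)) = mset (sub (kids T ! k) (w @ [m]) # gs) \<Longrightarrow>
      mset (map shape (kids (repl (kids T ! k) w
        (ONd (gs @ hs @ [repl (ts ! j) q (ONd [sub (ts ! j) q, ts ! i])]))))) = N'"
    unfolding Let_def by blast
  show ?case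
  proof (rule exI[of _ "k # w"], rule exI[of _ m], rule exI[of _ i], rule exI[of _ j], rule exI[of _ q],
      intro conjI allI)
    show "ispos T ((k # w) @ [m, i])" "ispos T ((k # w) @ m # j # q)" "i \<noteq> j"
      using w k by (simp_all add: ispos_Cons)
    fix gs hs
    have *: "mset (map shape (kids (repl T (k # w) Z))) = add_mset (UNd N') G"
      if "mset (map shape (kids (repl (kids T ! k) w Z))) = N'" for Z
      using mset_map_update[OF k(1), of G "repl (kids T ! k) w Z"] cong.prems k
        shape_kids[of "repl (kids T ! k) w Z"] that
      by (simp add: kids_repl_Cons del: mset_map)
    show "let ts = kids (sub T ((k # w) @ [m])) in
      mset ts = mset (ts ! i # ts ! j # hs) \<longrightarrow> mset (kids (sub T (k # w))) = mset (sub T ((k # w) @ [m]) # gs) \<longrightarrow>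
      mset (map shape (kids (repl T (k # w) (ONd (gs @ hs @ [repl (ts ! j) q (ONd [sub (ts ! j) q, ts ! i])])))))
        = add_mset (UNd N') G"
      unfolding Let_def append_Cons sub_Cons by (intro impI * res refl)
  qed
qed

lemma rmove_step:
  assumes "rmove M M'" "UNd M \<in> Tn_o n" "n > 0"
  shows "UNd M' \<in> set_pmf (step (UNd M))"
proof -
  let ?u = "UNd M"
  let ?T = "rep ?u"
  have val: "rdegs UNIV (- {1}) ?T" and nl: "nleaves ?u > 0"
    using assms(2,3) Tn_o_shape[of ?T n] by (simp_all add: shape_rep)
  have M: "mset (map shape (kids ?T)) = M"
    using shape_rep[of ?u] shape_kids[of ?T] by simp
  from assms(1) consider "move M M'"
    | A B H X where "ins A B X" "M = add_mset A (add_mset B H)" "M' = add_mset X H"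
    unfolding rmove_def by blast
  then show ?thesis
  proof cases
    case 1
    from move_position[OF 1 M] obtain w m i j q where w: "ispos ?T (w @ [m, i])"
      "ispos ?T (w @ m # j # q)" "i \<noteq> j" and
      res: "\<And>gs hs ts. ts = kids (sub ?T (w @ [m])) \<Longrightarrow>
        mset ts = mset (ts ! i # ts ! j # hs) \<Longrightarrow>
        mset (kids (sub ?T w)) = mset (sub ?T (w @ [m]) # gs) \<Longrightarrow>
        mset (map shape (kids (repl ?T w
          (ONd (gs @ hs @ [repl (ts ! j) q (ONd [sub (ts ! j) q, ts ! i])]))))) = M'"
      unfolding Let_def by blast
    define ts where "ts = kids (sub ?T (w @ [m]))"
    have "ispos ?T ((w @ [m]) @ [i])" "ispos ?T ((w @ [m]) @ j # q)" using w by simp_all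
    from planting_step[OF val nl this w(3)] obtain hs gs where
      hs: "mset ts = mset (ts ! i # ts ! j # hs)" and
      gs: "mset (kids (sub ?T w)) = mset (sub ?T (w @ [m]) # gs)" and
      st: "shape (repl ?T w (ONd (gs @ hs @ [repl (ts ! j) q (ONd [sub (ts ! j) q, ts ! i])]))) \<in> set_pmf (step ?u)"
      unfolding ts_def by blast
    show ?thesis using st res[OF ts_def hs gs] by (simp only: shape_kids)
  next
    case 2
    from mset_map_nth2[of shape "kids ?T"] M 2(2) obtain i j where
      ij: "i < length (kids ?T)" "j < length (kids ?T)" "i \<noteq> j" "shape (kids ?T ! i) = A" "shape (kids ?T ! j) = B"
      by blast
    obtain q where q: "ispos (kids ?T ! j) q" "shape (repl (kids ?T ! j) q (ONd [sub (kids ?T ! j) q, kids ?T ! i])) = X"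
      using ins_position[OF 2(1) ij(5,4)] by blast
    have "ispos ?T ([] @ [i])" "ispos ?T ([] @ j # q)" using ij q by (simp_all add: ispos_Cons)
    from planting_step[OF val nl this ij(3)] obtain hs where
      hs: "mset (kids ?T) = mset (kids ?T ! i # kids ?T ! j # hs)" and
      st: "shape (ONd (hs @ [repl (kids ?T ! j) q (ONd [sub (kids ?T ! j) q, kids ?T ! i])])) \<in> set_pmf (step ?u)"
      by auto
    have "mset (map shape hs) = H" using arg_cong[OF hs, of "image_mset shape"] M 2(2) ij by simp
    then show ?thesis using st q(2) by (simp add: shape_kids[of "ONd _"] 2(3))
  qed
qed

text \<open>Each move is a transition, so moves inherit the invariance of \<open>Tn_o n\<close> from
  the chain; in particular they preserve the number of leaves.\<close>

lemma rmoves_accessible: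
  assumes "rmove\<^sup>*\<^sup>* M M'" "UNd M \<in> Tn_o n" "n > 0"
  shows "accessible (UNd M) (UNd M') \<and> UNd M' \<in> Tn_o n"
  using assms(1)
proof (induction rule: rtranclp_induct)
  case base
  then show ?case using assms by (simp add: accessible_def)
next
  case (step N N')
  then have st: "UNd N' \<in> set_pmf (step (UNd N))" using rmove_step assms(3) by blast
  then have "accessible (UNd M) (UNd N')"
    using step.IH unfolding accessible_def by (auto intro: rtrancl_into_rtrancl)
  then show ?case using st step.IH step_Tn_o assms(3) by blast
qed

section \<open>Communicating classes and convergence\<close>

lemma moves_rmoves: "move\<^sup>*\<^sup>* M M' \<Longrightarrow> rmove\<^sup>*\<^sup>* M M'"
  by (induction rule: rtranclp_induct) (auto simp: rmove_def intro: rtranclp.rtrancl_into_rtrancl)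

lemma accessible_trans: "accessible x y \<Longrightarrow> accessible y z \<Longrightarrow> accessible x z"
  by (auto simp: accessible_def)

lemma accessible_closed:
  assumes "\<And>x. x \<in> C \<Longrightarrow> set_pmf (step x) \<subseteq> C" "accessible x y" "x \<in> C" shows "y \<in> C"
  using assms(2,3) unfolding accessible_def
  by (induction rule: rtrancl_induct) (use assms(1) in auto)

lemma Tn_bo_iff: "UNd M \<in> Tn_bo n \<longleftrightarrow> (\<exists>s. M = {#s#} \<and> binsub s \<and> lcount s = n)"
proof
  assume M: "UNd M \<in> Tn_bo n"
  then have "size M = 1" by (auto simp: Tn_bo_def)
  then obtain s where "M = {#s#}" using size_1_singleton_mset by blast
  then show "\<exists>s. M = {#s#} \<and> binsub s \<and> lcount s = n"
    using M by (auto simp: Tn_bo_def Tn_o_def nleaves_def)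
next
  assume "\<exists>s. M = {#s#} \<and> binsub s \<and> lcount s = n"
  then obtain s where s: "M = {#s#}" "binsub s" "lcount s = n" by blast
  obtain S where S: "shape S = s" using ex_shape by blast
  have "nodeg2 s" using s(2) degs_mono[of "{0, 2}" S "- {1}"]
    unfolding S[symmetric] nodeg2_shape binsub_shape by auto
  then show "UNd M \<in> Tn_bo n" using s by (auto simp: Tn_bo_def Tn_o_def nleaves_def)
qed

definition caterpillar :: "nat \<Rightarrow> utree" where
  "caterpillar n = UNd {#comb (n - 1)#}"

lemma caterpillar_Tn_bo: "n > 0 \<Longrightarrow> caterpillar n \<in> Tn_bo n"
  by (simp add: caterpillar_def Tn_bo_iff binsub_comb lcount_comb)

lemma accessible_caterpillar:
  assumes "x \<in> Tn_o n" "n > 0" shows "accessible x (caterpillar n)"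
proof (cases x)
  case (UNd M)
  have M: "M \<noteq> {#}" "\<forall>s\<in>#M. nodeg2 s" using assms UNd by (auto simp: Tn_o_def nleaves_def)
  obtain s where s: "rmove\<^sup>*\<^sup>* M {#s#}" "binsub s" using rmoves_to_binary[OF M] by blast
  have "UNd {#s#} \<in> Tn_o n" using rmoves_accessible[OF s(1)] assms UNd by blast
  then have "lcount s = n" by (simp add: Tn_o_def nleaves_def)
  then have "rmove\<^sup>*\<^sup>* M {#comb (n - 1)#}"
    using s moves_rmoves[OF moves_to_comb[OF s(2)]] by (auto intro: rtranclp_trans)
  then show ?thesis using rmoves_accessible assms unfolding UNd caterpillar_def by blast
qed

lemma caterpillar_accessible:
  assumes "y \<in> Tn_bo n" "n > 0" shows "accessible (caterpillar n) y"
proof (cases y)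
  case (UNd M)
  then obtain s where s: "M = {#s#}" "binsub s" "lcount s = n" using assms Tn_bo_iff by blast
  have "UNd {#comb (n - 1)#} \<in> Tn_o n"
    using caterpillar_Tn_bo[OF assms(2)] Tn_bo_subset by (auto simp: caterpillar_def)
  then show ?thesis using rmoves_accessible[OF moves_rmoves[OF moves_from_comb[OF s(2)]]] s assms(2)
    unfolding UNd caterpillar_def by blast
qed

lemma caterpillar_loop:
  assumes "n \<ge> 2" shows "caterpillar n \<in> set_pmf (step (caterpillar n))"
proof -
  obtain k where k: "n - 1 = Suc k" using assms by (cases "n - 1") auto
  have "move {#comb (n - 1)#} {#comb (n - 1)#}"
    unfolding k comb.simps by (rule move_ins[OF ins.top])
  then have "rmove {#comb (n - 1)#} {#comb (n - 1)#}" by (simp add: rmove_def)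
  moreover have "UNd {#comb (n - 1)#} \<in> Tn_o n"
    using caterpillar_Tn_bo[of n] assms Tn_bo_subset by (auto simp: caterpillar_def)
  ultimately show ?thesis using rmove_step assms unfolding caterpillar_def by simp
qed

text \<open>A closed class contains the caterpillar, which is reachable from all states, and with it
  every binary tree. It contains nothing else, because its states are reachable from the caterpillar
  and transitions never leave \<open>Tn_bo n\<close>.\<close>

lemma closed_comm_class_iff:
  assumes n: "n > 0" shows "closed_comm_class n C \<longleftrightarrow> C = Tn_bo n"
proof
  assume C: "closed_comm_class n C"
  then have cl: "\<And>x. x \<in> C \<Longrightarrow> set_pmf (step x) \<subseteq> C" by (auto simp: closed_comm_class_def)
  obtain x where x: "x \<in> C" "x \<in> Tn_o n" using C by (auto simp: closed_comm_class_def)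
  have cat: "caterpillar n \<in> C" using accessible_closed[OF cl accessible_caterpillar[OF x(2) n] x(1)] .
  have "Tn_bo n \<subseteq> C" using accessible_closed[OF cl caterpillar_accessible[OF _ n] cat] by blast
  moreover have "y \<in> Tn_bo n" if "y \<in> C" for y
  proof -
    have "accessible (caterpillar n) y" using C cat that by (auto simp: closed_comm_class_def)
    then show ?thesis using accessible_closed[OF step_Tn_bo[OF _ n]] caterpillar_Tn_bo[OF n] by blast
  qed
  ultimately show "C = Tn_bo n" by blast
next
  assume C: "C = Tn_bo n"
  have "accessible x y" if "x \<in> Tn_bo n" "y \<in> Tn_bo n" for x y
    using that accessible_caterpillar[OF _ n] caterpillar_accessible[OF _ n] Tn_bo_subset accessible_trans by blast
  then show "closed_comm_class n C"
    unfolding closed_comm_class_def C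
    using caterpillar_Tn_bo[OF n] Tn_bo_subset step_Tn_bo[OF _ n] accessible_closed[OF step_Tn_bo[OF _ n]]
    by blast
qed

lemma law_eq: "law \<mu> k = bind_pmf \<mu> (kpow step k)"
  by (simp add: law_def funpow_bind_pmf)

lemma stationary_law: "bind_pmf \<pi> step = \<pi> \<Longrightarrow> law \<pi> k = \<pi>"
  by (induction k) (auto simp: law_def)

theorem mainTheorem6:
  fixes n :: nat
  assumes "n \<ge> 2"
  shows "(\<forall>C. closed_comm_class n C \<longleftrightarrow> C = Tn_bo n)
       \<and> (\<exists>!\<pi>. stationary n \<pi>)
       \<and> (\<forall>\<pi>. stationary n \<pi> \<longrightarrow>
            set_pmf \<pi> \<subseteq> Tn_bo n
          \<and> (\<forall>\<mu>. set_pmf \<mu> \<subseteq> Tn_o n \<longrightarrow>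
                 (\<forall>t. (\<lambda>k. pmf (law \<mu> k) t) \<longlonglongrightarrow> pmf \<pi> t)))"
proof -
  have n: "n > 0" using assms by simp
  have cat: "caterpillar n \<in> Tn_o n" using caterpillar_Tn_bo[OF n] Tn_bo_subset by blast
  have "(x, caterpillar n) \<in> {(x, y). y \<in> set_pmf (step x)}\<^sup>*" if "x \<in> Tn_o n" for x
    using accessible_caterpillar[OF that n] by (simp add: accessible_def)
  then obtain N where "\<forall>x\<in>Tn_o n. caterpillar n \<in> set_pmf (kpow step N x)"
    using exists_common_time[where S = "Tn_o n" and t = "caterpillar n" and K = step,
        OF finite_Tn_o _ caterpillar_loop[OF assms]] by blast
  then interpret doeblin_chain step "Tn_o n" "caterpillar n" N
    using finite_Tn_o cat step_Tn_o[OF _ n] by unfold_locales auto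
  obtain \<pi> where \<pi>: "set_pmf \<pi> \<subseteq> Tn_o n" "bind_pmf \<pi> step = \<pi>"
    and lim: "\<And>\<mu> y. set_pmf \<mu> \<subseteq> Tn_o n \<Longrightarrow> (\<lambda>k. pmf (law \<mu> k) y) \<longlonglongrightarrow> pmf \<pi> y"
    using convergence unfolding law_eq by blast
  \<comment> \<open>Started in a stationary law the chain has a constant law, which also converges
    to the limit law.\<close>
  have uniq: "\<pi>' = \<pi>" if "stationary n \<pi>'" for \<pi>'
  proof (rule pmf_eqI)
    fix y
    have "(\<lambda>k. pmf \<pi>' y) \<longlonglongrightarrow> pmf \<pi> y"
      using lim[of \<pi>' y] that by (simp add: stationary_def stationary_law)
    then show "pmf \<pi>' y = pmf \<pi> y" by (simp add: LIMSEQ_const_iff)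
  qed
  have stat: "stationary n \<pi>" using \<pi> by (simp add: stationary_def)
  \<comment> \<open>Started at the caterpillar the chain stays binary, so the limit law gives no
    mass to other trees.\<close>
  have supp: "y \<in> Tn_bo n" if y: "y \<in> set_pmf \<pi>" for y
  proof (rule ccontr)
    assume nb: "y \<notin> Tn_bo n"
    have "pmf (law (return_pmf (caterpillar n)) k) y = 0" for k
    proof -
      have "set_pmf (kpow step k (caterpillar n)) \<subseteq> Tn_bo n"
        using step_Tn_bo[OF _ n] caterpillar_Tn_bo[OF n] by (rule set_kpow_subset)
      then show ?thesis using nb by (auto simp: law_eq bind_return_pmf set_pmf_iff)
    qed
    then have "(\<lambda>k. 0) \<longlonglongrightarrow> pmf \<pi> y" using lim[of "return_pmf (caterpillar n)" y] cat by simp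
    then show False using y by (simp add: LIMSEQ_const_iff set_pmf_iff)
  qed
  show ?thesis
  proof (intro conjI allI impI)
    show "closed_comm_class n C \<longleftrightarrow> C = Tn_bo n" for C by (rule closed_comm_class_iff[OF n])
    show "\<exists>!\<pi>. stationary n \<pi>" using stat uniq by (rule ex1I)
  next
    fix \<pi>' assume "stationary n \<pi>'"
    then have eq: "\<pi>' = \<pi>" by (rule uniq)
    show "set_pmf \<pi>' \<subseteq> Tn_bo n" unfolding eq using supp by blast
    show "(\<lambda>k. pmf (law \<mu> k) t) \<longlonglongrightarrow> pmf \<pi>' t" if "set_pmf \<mu> \<subseteq> Tn_o n" for \<mu> t
      unfolding eq by (rule lim[OF that])
  qed
qed

end
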